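(* Let $s \in (0,\infty)$ and let $f:\mathbb{R}^d \to [0,\infty)$ be an upper semi-continuous, $1/s$-concave function with finite integral. For a vector $z\in\mathbb{R}^d$ write $f_{[z]}(x) = f(x+z)$, $x\in\mathbb{R}^d$. Then: (1) The function $z \mapsto \int_{\mathbb{R}^d} \mathcal{L}_s\bigl(f_{[z]}\bigr)$ is convex on the interior of the support of $f$. It attains its minimum at a point $\tilde z$ such that the origin is the barycenter of $\mathcal{L}_s\bigl(f_{[\tilde z]}\bigr)$. (2) The function $$z \mapsto \left( \int_{\mathbb{R}^d} \mathcal{L}_s\bigl(f_{[z]}\bigr) \right)^{-\frac{1}{d+s}}$$ is concave on the interior of the support of $f$.
   Context: The support of a non-negative function $f$ on $\mathbb{R}^d$ is the set $\operatorname{supp} f = \{x\in\mathbb{R}^d : f(x)>0\}$. For $s>0$, a non-negative function $f$ on $\mathbb{R}^d$ is $1/s$-concave if $f^{1/s}$ is concave on its support (in particular, the support is convex). For $s>0$ the $s$-polar transform of $f$ is $$\mathcal{L}_s f(y) = \inf_{\{x : f(x)>0\}} \frac{(1-\langle x,y\rangle)_+^{s}}{f(x)}, \qquad (a)_+ = \max\{a,0\}.$$ The barycenter of an integrable function $g$ on $\mathbb{R}^d$ is $\frac{\int_{\mathbb{R}^d} x\, g(x)\,dx}{\int_{\mathbb{R}^d} g}$, if the quotient exists. *)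

theory Defs
  imports "HOL-Analysis.Analysis"
begin

definition upper_semicontinuous :: "('a::topological_space \<Rightarrow> real) \<Rightarrow> bool" where
  "upper_semicontinuous f \<longleftrightarrow> (\<forall>x c. f x < c \<longrightarrow> (\<forall>\<^sub>F y in nhds x. f y < c))"

(* The set where f is positive; no closure is taken. *)
definition supp :: "('a \<Rightarrow> real) \<Rightarrow> 'a set" where
  "supp f = {x. f x > 0}"

(* Convexity of the support is part of the library's concave_on. *)
definition one_over_s_concave :: "real \<Rightarrow> ('a::real_vector \<Rightarrow> real) \<Rightarrow> bool" where
  "one_over_s_concave s f \<longleftrightarrow> (\<forall>x. f x \<ge> 0) \<and> concave_on (supp f) (\<lambda>x. f x powr (1 / s))"

(* Valued in ennreal, so that the infimum over an empty support is infinity.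
   For s > 0 the convention 0 powr s = 0 gives the intended value of the numerator. *)
definition s_polar :: "real \<Rightarrow> ('a::euclidean_space \<Rightarrow> real) \<Rightarrow> 'a \<Rightarrow> ennreal" where
  "s_polar s f y = (INF x\<in>supp f. ennreal (max (1 - x \<bullet> y) 0 powr s / f x))"

definition shift :: "('a::plus \<Rightarrow> real) \<Rightarrow> 'a \<Rightarrow> 'a \<Rightarrow> real" where
  "shift f z = (\<lambda>x. f (x + z))"

(* The function that sends z to the integral of the s-polar of the shift of f by z. *)
definition polar_integral :: "real \<Rightarrow> ('a::euclidean_space \<Rightarrow> real) \<Rightarrow> 'a \<Rightarrow> ennreal" where
  "polar_integral s f z = (\<integral>\<^sup>+ y. s_polar s (shift f z) y \<partial>lborel)"

(* A relation rather than a function, so that existence of the quotient is part of the claim. *)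
definition is_barycenter :: "('a::euclidean_space \<Rightarrow> real) \<Rightarrow> 'a \<Rightarrow> bool" where
  "is_barycenter g b \<longleftrightarrow>
     integrable lborel g \<and> integrable lborel (\<lambda>x. g x *\<^sub>R x) \<and>
     (\<integral>x. g x \<partial>lborel) \<noteq> 0 \<and>
     b = (\<integral>x. g x *\<^sub>R x \<partial>lborel) /\<^sub>R (\<integral>x. g x \<partial>lborel)"

end

theory Submission
  imports Defs
begin

text \<open>
  Put \<open>W(v, \<lambda>) = sup\<^sub>x (\<langle>x, v\<rangle> + (\<lambda> f(x))\<^bsup>1/s\<^esup>)\<close> for \<open>\<lambda> > 0\<close>, the supremum being over the support
  of \<open>f\<close>, and \<open>G\<^sub>z(v, \<lambda>) = W(v, \<lambda>) - \<langle>z, v\<rangle>\<close>. Solving for \<open>\<lambda>\<close> the inequality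
  \<open>\<lambda> f(x) \<le> (1 - \<langle>x - z, v\<rangle>)\<^sub>+\<^sup>s\<close> shows that \<open>G\<^sub>z(v, \<lambda>) \<le> 1\<close> holds exactly if \<open>\<lambda>\<close> is at most the
  \<open>s\<close>-polar of the shifted function at \<open>v\<close> (\<open>polar_gauge_le_1_iff\<close>). So the polar integral \<open>I(z)\<close>
  is the volume of \<open>{G\<^sub>z \<le> 1}\<close> in \<open>d + 1\<close> dimensions. The gauge satisfies
  \<open>G\<^sub>z(t v, t\<^sup>s \<lambda>) = t G\<^sub>z(v, \<lambda>)\<close>, hence \<open>{G\<^sub>z \<le> t}\<close> has volume \<open>t\<^bsup>d+s\<^esup> I(z)\<close>, and the layer cake
  formula for \<open>exp (- G\<^sub>z)\<close> gives
  \<open>\<Gamma>(d + s + 1) I(z) = \<integral>\<integral> exp (\<langle>z, v\<rangle> - W(v, \<lambda>)) d\<lambda> dv\<close>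
  for \<open>z\<close> in the closure of the support (\<open>polar_moment_laplace\<close>). Up to a constant \<open>I\<close> is
  therefore a Laplace transform, and everything follows from the convexity of \<open>exp\<close>.

  Convexity of \<open>I\<close> is immediate. For the concavity of \<open>I\<^bsup>-1/(d+s)\<^esup>\<close> one rescales:
  \<open>\<integral>\<integral> exp (- c G\<^sub>z) = c\<^bsup>-(d+s)\<^esup> \<Gamma>(d + s + 1) I(z)\<close>. With \<open>\<alpha> = I(a)\<^bsup>-1/(d+s)\<^esup>\<close>,
  \<open>\<beta> = I(b)\<^bsup>-1/(d+s)\<^esup>\<close>, \<open>z = u a + v b\<close> and \<open>S = u \<alpha> + v \<beta>\<close>, the function \<open>G\<^sub>z / S\<close> is a convex
  combination of \<open>G\<^sub>a / \<alpha>\<close> and \<open>G\<^sub>b / \<beta>\<close>, both of which are normalised to have the integral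
  \<open>\<Gamma>(d + s + 1)\<close>. Hence \<open>S\<^bsup>d+s\<^esup> I(z) \<le> 1\<close>, which is the claim (\<open>concave_polar_integral_power\<close>).

  An integrable function with a concave power and a support with interior is bounded with bounded
  support, because convex sets of finite volume with interior are bounded
  (\<open>convex_finite_measure_bounded\<close>). This makes \<open>I\<close> finite on the interior of the support. Outside
  it a separating hyperplane gives a ray in the polar body of the support, so \<open>I\<close> is infinite there
  (\<open>polar_integral_outside_interior\<close>). By Fatou's lemma a limit point of a minimising sequence is a
  minimum, and it is interior since the value at it is finite. At the minimum the derivative of the
  Laplace transform vanishes, i.e. \<open>\<integral>\<integral> v exp (- G\<^sub>z) = 0\<close>. The layer cake argument with the extra
  weight \<open>v\<close>, homogeneous of degree one, turns this integral into a multiple of the first moment of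
  the polar, so the barycenter is the origin (\<open>is_barycenter_at_minimum\<close>).
\<close>

section \<open>Scaling of Lebesgue integrals and a Laplace transform\<close>

lemma borel_measurable_fst_borel [measurable (raw)]:
  fixes g :: "'c \<Rightarrow> 'a::second_countable_topology \<times> 'b::second_countable_topology"
  assumes "g \<in> borel_measurable M"
  shows "(\<lambda>x. fst (g x)) \<in> borel_measurable M"
  using measurable_compose[OF assms, of fst borel] by (simp add: borel_prod[symmetric])

lemma borel_measurable_snd_borel [measurable (raw)]:
  fixes g :: "'c \<Rightarrow> 'a::second_countable_topology \<times> 'b::second_countable_topology"
  assumes "g \<in> borel_measurable M"
  shows "(\<lambda>x. snd (g x)) \<in> borel_measurable M"
  using measurable_compose[OF assms, of snd borel] by (simp add: borel_prod[symmetric])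

lemma nn_integral_lborel_scaleR:
  fixes F :: "'a::euclidean_space \<Rightarrow> ennreal"
  assumes [measurable]: "F \<in> borel_measurable borel" and "t > 0"
  shows "(\<integral>\<^sup>+x. F x \<partial>lborel) = ennreal (t ^ DIM('a)) * (\<integral>\<^sup>+x. F (t *\<^sub>R x) \<partial>lborel)"
  using \<open>t > 0\<close>
  by (subst lborel_affine[of t 0])
    (simp_all add: nn_integral_density nn_integral_distr nn_integral_cmult)

text \<open>
  The last coordinate scales as \<open>t\<^sup>s\<close> because it stands for the values of an \<open>s\<close>-polar, which are
  \<open>s\<close>-homogeneous when the constant \<open>1\<close> in the polar is scaled along with the vector.
\<close>
lemma nn_integral_lborel_anisotropic_scaling:
  fixes F :: "'a::euclidean_space \<times> real \<Rightarrow> ennreal"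
  assumes [measurable]: "F \<in> borel_measurable borel" and "t > 0"
  shows "(\<integral>\<^sup>+p. F p \<partial>lborel) =
    ennreal (t powr (real DIM('a) + s)) * (\<integral>\<^sup>+p. F (t *\<^sub>R fst p, t powr s * snd p) \<partial>lborel)"
proof -
  have [measurable]: "F \<in> borel_measurable (borel \<Otimes>\<^sub>M borel)"
    by (simp add: borel_prod)
  have "(\<integral>\<^sup>+p. F p \<partial>lborel) = (\<integral>\<^sup>+v. \<integral>\<^sup>+l. F (v, l) \<partial>lborel \<partial>lborel)"
    by (subst lborel_prod[symmetric]) (simp add: lborel.nn_integral_fst)
  also have "\<dots> = (\<integral>\<^sup>+v. ennreal (t powr s) * (\<integral>\<^sup>+l. F (v, t powr s * l) \<partial>lborel) \<partial>lborel)"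
    using \<open>t > 0\<close>
    by (intro nn_integral_cong) (subst nn_integral_real_affine[where c = "t powr s" and t = 0]; simp)
  also have "\<dots> = ennreal (t powr s) * (\<integral>\<^sup>+v. \<integral>\<^sup>+l. F (v, t powr s * l) \<partial>lborel \<partial>lborel)"
    by (rule nn_integral_cmult) measurable
  also have "\<dots> = ennreal (t powr s) * (ennreal (t ^ DIM('a)) *
      (\<integral>\<^sup>+v. \<integral>\<^sup>+l. F (t *\<^sub>R v, t powr s * l) \<partial>lborel \<partial>lborel))"
    by (subst nn_integral_lborel_scaleR[OF _ \<open>t > 0\<close>]) simp_all
  also have "\<dots> = ennreal (t powr (real DIM('a) + s)) *
      (\<integral>\<^sup>+v. \<integral>\<^sup>+l. F (t *\<^sub>R v, t powr s * l) \<partial>lborel \<partial>lborel)"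
    using \<open>t > 0\<close>
    by (simp add: powr_add powr_realpow ennreal_mult' mult_ac)
  also have "(\<integral>\<^sup>+v. \<integral>\<^sup>+l. F (t *\<^sub>R v, t powr s * l) \<partial>lborel \<partial>lborel) =
      (\<integral>\<^sup>+p. F (t *\<^sub>R fst p, t powr s * snd p) \<partial>lborel)"
  proof -
    have "(\<lambda>p. F (t *\<^sub>R fst p, t powr s * snd p)) \<in> borel_measurable (lborel \<Otimes>\<^sub>M lborel)"
      by measurable
    from lborel.nn_integral_fst[OF this] show ?thesis
      by (simp add: lborel_prod)
  qed
  finally show ?thesis .
qed

text \<open>
  Layer cake: \<open>exp (- G) = \<integral> exp (- t) [G \<le> t] dt\<close>, and by scaling the \<open>q\<close>-weighted volume of
  \<open>{G \<le> t}\<close> is \<open>t\<^bsup>d+s+k\<^esup>\<close> times that of \<open>{G \<le> 1}\<close>; what remains is Euler's integral. The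
  weight \<open>q\<close> can carry the indicator of a half-space on which alone \<open>G\<close> is a gauge.
\<close>
lemma nn_integral_exp_quasi_homogeneous:
  fixes G :: "'a::euclidean_space \<times> real \<Rightarrow> real" and q :: "'a \<times> real \<Rightarrow> ennreal"
  assumes [measurable]: "G \<in> borel_measurable borel" "q \<in> borel_measurable borel"
    and G_nonneg: "\<And>p. q p \<noteq> 0 \<Longrightarrow> 0 \<le> G p"
    and G_scale: "\<And>t v l. t > 0 \<Longrightarrow> q (v, l) \<noteq> 0 \<Longrightarrow> G (t *\<^sub>R v, t powr s * l) = t * G (v, l)"
    and q_scale: "\<And>t v l. t > 0 \<Longrightarrow> q (t *\<^sub>R v, t powr s * l) = ennreal (t powr k) * q (v, l)"
    and pos: "real DIM('a) + s + k + 1 > 0"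
  shows "(\<integral>\<^sup>+p. q p * ennreal (exp (- G p)) \<partial>lborel) =
    ennreal (Gamma (real DIM('a) + s + k + 1)) * (\<integral>\<^sup>+p. q p * indicator {p. G p \<le> 1} p \<partial>lborel)"
proof -
  let ?m = "real DIM('a) + s + k"
  let ?J = "\<lambda>t. \<integral>\<^sup>+p. q p * indicator {p. G p \<le> t} p \<partial>(lborel :: ('a \<times> real) measure)"
  have exp_layers: "ennreal (exp (- c)) = (\<integral>\<^sup>+t. ennreal (exp (- t)) * indicator {c..} t \<partial>lborel)" for c :: real
  proof -
    have "(\<integral>\<^sup>+t. ennreal (exp (- t)) * indicator {c..} t \<partial>lborel) = ennreal (0 - (- exp (- c)))"
    proof (rule nn_integral_FTC_atLeast)
      show "((\<lambda>t. - exp (- t)) \<longlongrightarrow> (0 :: real)) at_top"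
        using tendsto_minus[OF filterlim_compose[OF exp_at_bot filterlim_uminus_at_bot_at_top]] by simp
    qed (auto intro!: derivative_eq_intros)
    then show ?thesis by simp
  qed
  have J_scale: "?J t = ennreal (t powr ?m) * ?J 1" if "t > 0" for t
  proof -
    have "?J t = ennreal (t powr (real DIM('a) + s)) * (\<integral>\<^sup>+p. q (t *\<^sub>R fst p, t powr s * snd p) *
        indicator {p. G p \<le> t} (t *\<^sub>R fst p, t powr s * snd p) \<partial>lborel)"
      by (rule nn_integral_lborel_anisotropic_scaling[OF _ that]) measurable
    also have "(\<integral>\<^sup>+p. q (t *\<^sub>R fst p, t powr s * snd p) *
        indicator {p. G p \<le> t} (t *\<^sub>R fst p, t powr s * snd p) \<partial>lborel) =
        (\<integral>\<^sup>+p. ennreal (t powr k) * (q p * indicator {p. G p \<le> 1} p) \<partial>lborel)"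
    proof (intro nn_integral_cong)
      fix p :: "'a \<times> real"
      show "q (t *\<^sub>R fst p, t powr s * snd p) * indicator {p. G p \<le> t} (t *\<^sub>R fst p, t powr s * snd p)
          = ennreal (t powr k) * (q p * indicator {p. G p \<le> 1} p)"
        using G_scale[of t "fst p" "snd p"] q_scale[of t "fst p" "snd p"] that
        by (cases "q p = 0") (auto simp: indicator_def)
    qed
    also have "\<dots> = ennreal (t powr k) * ?J 1"
      by (rule nn_integral_cmult) measurable
    finally show ?thesis
      by (simp add: powr_add ennreal_mult' mult_ac)
  qed
  have "(\<integral>\<^sup>+p. q p * ennreal (exp (- G p)) \<partial>lborel) =
      (\<integral>\<^sup>+p. (\<integral>\<^sup>+t. q p * (ennreal (exp (- t)) * indicator {G p..} t) \<partial>lborel) \<partial>lborel)"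
    by (intro nn_integral_cong) (simp add: nn_integral_cmult exp_layers[symmetric])
  also have "\<dots> = (\<integral>\<^sup>+t. (\<integral>\<^sup>+p. q p * (ennreal (exp (- t)) * indicator {G p..} t) \<partial>lborel) \<partial>lborel)"
  proof (rule lborel_pair.Fubini')
    have [measurable]: "Measurable.pred (lborel \<Otimes>\<^sub>M lborel) (\<lambda>x. fst x \<in> {G (snd x)..})"
      unfolding atLeast_iff by measurable
    show "(\<lambda>(t, p). q p * (ennreal (exp (- t)) * indicator {G p..} t)) \<in> borel_measurable (lborel \<Otimes>\<^sub>M lborel)"
      unfolding split_beta' by measurable
  qed
  also have "\<dots> = (\<integral>\<^sup>+t. ennreal (indicator {0..} t * t powr ?m / exp t) * ?J 1 \<partial>lborel)"
  \<comment> \<open>Scaling says nothing about the level \<open>t = 0\<close>, which is a null set of levels.\<close>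
  proof (rule nn_integral_cong_AE, rule AE_mp[OF AE_lborel_singleton[of "0::real"]], intro AE_I2 impI)
    fix t :: real assume "t \<noteq> 0"
    have "(\<integral>\<^sup>+p. q p * (ennreal (exp (- t)) * indicator {G p..} t) \<partial>lborel) = ennreal (exp (- t)) * ?J t"
      by (subst nn_integral_cmult[symmetric]) (auto intro!: nn_integral_cong simp: indicator_def mult_ac)
    also have "\<dots> = ennreal (indicator {0..} t * t powr ?m / exp t) * ?J 1"
    proof (cases "t > 0")
      case True
      then show ?thesis
        unfolding J_scale[OF True] by (simp add: ennreal_mult'[symmetric] mult.assoc[symmetric] exp_minus field_simps)
    next
      case False
      with \<open>t \<noteq> 0\<close> have "t < 0" by simp
      then have "q p * indicator {p. G p \<le> t} p = 0" for p
        using G_nonneg[of p] by (auto simp: indicator_def)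
      then have "?J t = 0" by (simp only: nn_integral_const mult_zero_left)
      then show ?thesis using \<open>t < 0\<close> by simp
    qed
    finally show "(\<integral>\<^sup>+p. q p * (ennreal (exp (- t)) * indicator {G p..} t) \<partial>lborel) =
        ennreal (indicator {0..} t * t powr ?m / exp t) * ?J 1" .
  qed
  also have "\<dots> = ennreal (Gamma (?m + 1)) * ?J 1"
    by (subst nn_integral_multc) (use pos in \<open>simp_all add: Gamma_conv_nn_integral_real\<close>)
  finally show ?thesis .
qed

section \<open>Convex sets of finite volume\<close>

text \<open>
  If the set contains a ball of radius \<open>r\<close> and a point \<open>x\<close> far away, then by convexity the half of
  the segment from the centre towards \<open>x\<close> is surrounded by balls of radius \<open>r / 2\<close> in the set. Many
  of them are disjoint when \<open>x\<close> is far, and they exhaust any finite volume.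
\<close>
lemma convex_finite_measure_bounded:
  fixes S :: "'a::euclidean_space set"
  assumes "convex S" "S \<in> sets borel" "interior S \<noteq> {}" "emeasure lborel S < \<infinity>"
  shows "bounded S"
proof (rule ccontr)
  assume unbounded: "\<not> bounded S"
  obtain a r where r: "r > 0" "ball a r \<subseteq> S"
    using assms(3) by (meson all_not_in_conv mem_interior)
  define \<beta> where "\<beta> = measure lborel (ball (0::'a) (r / 2))"
  have "\<beta> > 0"
    using r by (simp add: \<beta>_def content_ball_pos)
  have ball_eq: "emeasure lborel (ball c (r / 2)) = ennreal \<beta>" for c :: 'a
    using r by (simp add: \<beta>_def emeasure_ball content_ball)
  have bound: "of_nat n * ennreal \<beta> \<le> emeasure lborel S" if "n > 0" for n :: nat
  proof -
    obtain x where x: "x \<in> S" "2 * real n * r < dist a x"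
      using unbounded by (metis bounded_any_center not_le)
    define c where "c i = a + (real i / (2 * real n)) *\<^sub>R (x - a)" for i :: nat
    have sub: "ball (c i) (r / 2) \<subseteq> S" if "i < n" for i
    proof
      fix y assume y: "y \<in> ball (c i) (r / 2)"
      define \<tau> where "\<tau> = real i / (2 * real n)"
      have \<tau>: "0 \<le> \<tau>" "\<tau> \<le> 1 / 2"
        using that by (auto simp: \<tau>_def field_simps)
      \<comment> \<open>The point of the big ball with \<open>y = (1 - \<tau>) w + \<tau> x\<close>.\<close>
      define w where "w = a + (1 / (1 - \<tau>)) *\<^sub>R (y - c i)"
      have "norm (w - a) < r"
      proof -
        have "norm (w - a) = norm (y - c i) / (1 - \<tau>)"
          using \<tau> by (simp add: w_def)
        also have "\<dots> < (r / 2) / (1 - \<tau>)"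
          using \<tau> y by (intro divide_strict_right_mono) (auto simp: dist_norm norm_minus_commute)
        also have "\<dots> \<le> r"
          using \<tau> r by (simp add: field_simps)
        finally show ?thesis .
      qed
      then have "w \<in> S"
        using r by (auto simp: dist_norm norm_minus_commute)
      have "(1 - \<tau>) *\<^sub>R w = (1 - \<tau>) *\<^sub>R a + (y - c i)"
        using \<tau> by (simp add: w_def scaleR_right_distrib)
      moreover have "c i = a + \<tau> *\<^sub>R (x - a)"
        by (simp add: c_def \<tau>_def)
      ultimately have "y = (1 - \<tau>) *\<^sub>R w + \<tau> *\<^sub>R x"
        by (simp add: algebra_simps)
      then show "y \<in> S"
        using \<open>w \<in> S\<close> x(1) \<tau> convexD_alt[OF assms(1)] by simp
    qed
    have disj: "disjoint_family_on (\<lambda>i. ball (c i) (r / 2)) {..<n}"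
      unfolding disjoint_family_on_def
    proof (intro ballI impI)
      fix i j assume ij: "i \<in> {..<n}" "j \<in> {..<n}" "i \<noteq> j"
      have "1 \<le> \<bar>real i - real j\<bar>"
        using ij(3) by linarith
      have "dist (c i) (c j) = \<bar>real i - real j\<bar> / (2 * real n) * dist a x"
      proof -
        have "c i - c j = ((real i - real j) / (2 * real n)) *\<^sub>R (x - a)"
          by (simp add: c_def scaleR_left_diff_distrib[symmetric] diff_divide_distrib)
        then show ?thesis
          by (simp add: dist_norm norm_minus_commute)
      qed
      also have "\<dots> \<ge> 1 / (2 * real n) * dist a x"
        using \<open>1 \<le> \<bar>real i - real j\<bar>\<close> by (intro mult_right_mono divide_right_mono) auto
      finally have "1 / (2 * real n) * dist a x \<le> dist (c i) (c j)" .
      moreover have "r < 1 / (2 * real n) * dist a x"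
        using x(2) \<open>n > 0\<close> by (simp add: field_simps)
      ultimately show "ball (c i) (r / 2) \<inter> ball (c j) (r / 2) = {}"
        using r by (intro disjoint_ballI) simp
    qed
    have "of_nat n * ennreal \<beta> = (\<Sum>i<n. emeasure lborel (ball (c i) (r / 2)))"
      by (simp add: ball_eq)
    also have "\<dots> = emeasure lborel (\<Union>i<n. ball (c i) (r / 2))"
      using disj by (intro sum_emeasure) auto
    also have "\<dots> \<le> emeasure lborel S"
      using sub assms(2) by (intro emeasure_mono) auto
    finally show ?thesis .
  qed
  obtain e where e: "emeasure lborel S = ennreal e" "e \<ge> 0"
    using assms(4) by (metis ennreal_cases infinity_ennreal_def less_irrefl)
  obtain n :: nat where n: "n > 0" "e / \<beta> < n"
    using reals_Archimedean2[of "max 1 (e / \<beta>)"] by (metis max_less_iff_conj of_nat_0_less_iff less_trans zero_less_one)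
  have "ennreal (real n * \<beta>) \<le> ennreal e"
    using bound[OF n(1)] \<open>\<beta> > 0\<close> e by (simp add: ennreal_mult' ennreal_of_nat_eq_real_of_nat)
  then show False
    using n \<open>\<beta> > 0\<close> e by (simp add: field_simps)
qed

section \<open>Stationarity of exponential moments\<close>

text \<open>
  The integral of \<open>a\<close> is the derivative at \<open>0\<close> of the exponential moments. The difference quotients
  with steps below \<open>\<delta> / 2\<close> are dominated by \<open>\<bar>a\<bar> exp (\<delta> \<bar>a\<bar> / 2)\<close>, which in turn is dominated by the
  integrable extreme moments: the other half of \<open>\<delta>\<close> absorbs the factor \<open>\<bar>a\<bar>\<close>.
\<close>
lemma integral_eq_0_if_exp_moment_minimal:
  fixes a :: "'a \<Rightarrow> real"
  assumes [measurable]: "a \<in> borel_measurable M" and "\<delta> > 0"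
    and int: "\<And>\<epsilon>. \<bar>\<epsilon>\<bar> \<le> \<delta> \<Longrightarrow> integrable M (\<lambda>x. exp (\<epsilon> * a x))"
    and min: "\<And>\<epsilon>. \<bar>\<epsilon>\<bar> \<le> \<delta> \<Longrightarrow> (\<integral>x. exp (0 * a x) \<partial>M) \<le> (\<integral>x. exp (\<epsilon> * a x) \<partial>M)"
  shows "integrable M a" and "(\<integral>x. a x \<partial>M) = 0"
proof -
  define w where "w x = (2 / \<delta>) * (exp (\<delta> * a x) + exp (- \<delta> * a x))" for x
  have w_int: "integrable M w"
    unfolding w_def using int[of \<delta>] int[of "- \<delta>"] \<open>\<delta> > 0\<close> by simp
  have exp_diff: "\<bar>exp y - 1\<bar> \<le> \<bar>y\<bar> * exp \<bar>y\<bar>" for y :: real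
  proof (cases "y \<ge> 0")
    case True
    have "exp y * (1 - y) \<le> exp y * exp (- y)"
      using exp_ge_add_one_self[of "- y"] by (intro mult_left_mono) auto
    then show ?thesis
      using True by (simp add: exp_minus algebra_simps)
  next
    case False
    have "1 + y \<le> exp y" "exp y \<le> 1"
      using False by (rule_tac exp_ge_add_one_self, simp)
    with False have "\<bar>exp y - 1\<bar> \<le> \<bar>y\<bar> * 1"
      by linarith
    also have "\<dots> \<le> \<bar>y\<bar> * exp \<bar>y\<bar>"
      by (intro mult_left_mono) auto
    finally show ?thesis .
  qed
  have w_bound: "\<bar>a x\<bar> * exp (\<delta> / 2 * \<bar>a x\<bar>) \<le> w x" for x
  proof -
    have "\<delta> / 2 * \<bar>a x\<bar> \<le> exp (\<delta> / 2 * \<bar>a x\<bar>)"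
      using exp_ge_add_one_self[of "\<delta> / 2 * \<bar>a x\<bar>"] by linarith
    then have "\<bar>a x\<bar> \<le> 2 / \<delta> * exp (\<delta> / 2 * \<bar>a x\<bar>)"
      using \<open>\<delta> > 0\<close> by (simp add: field_simps)
    then have "\<bar>a x\<bar> * exp (\<delta> / 2 * \<bar>a x\<bar>) \<le> 2 / \<delta> * exp (\<delta> / 2 * \<bar>a x\<bar>) * exp (\<delta> / 2 * \<bar>a x\<bar>)"
      by (intro mult_right_mono) auto
    also have "\<dots> = 2 / \<delta> * exp (\<delta> * \<bar>a x\<bar>)"
      by (simp add: exp_add[symmetric])
    also have "\<dots> \<le> w x"
      unfolding w_def using \<open>\<delta> > 0\<close> by (intro mult_left_mono) (auto simp: abs_if)
    finally show ?thesis .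
  qed
  have a_le: "\<bar>a x\<bar> \<le> w x" for x
  proof -
    have "\<bar>a x\<bar> * 1 \<le> \<bar>a x\<bar> * exp (\<delta> / 2 * \<bar>a x\<bar>)"
      using \<open>\<delta> > 0\<close> by (intro mult_left_mono) auto
    with w_bound[of x] show ?thesis by simp
  qed
  show "integrable M a"
    by (rule Bochner_Integration.integrable_bound[OF w_int])
      (use a_le in \<open>auto intro: order_trans[OF _ abs_ge_self]\<close>)
  have one_sided: "0 \<le> \<sigma> * (\<integral>x. a x \<partial>M)" if \<sigma>: "\<bar>\<sigma>\<bar> = 1" for \<sigma> :: real
  proof -
    define \<epsilon> where "\<epsilon> n = \<delta> / 2 / real (Suc n)" for n
    have \<epsilon>: "0 < \<epsilon> n" "\<epsilon> n \<le> \<delta> / 2" for n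
      using \<open>\<delta> > 0\<close> by (auto simp: \<epsilon>_def field_simps)
    have \<epsilon>_lim: "\<epsilon> \<longlonglongrightarrow> 0"
      unfolding \<epsilon>_def by (rule LIMSEQ_Suc[OF lim_const_over_n])
    define X where "X n x = (exp (\<epsilon> n * \<sigma> * a x) - 1) / \<epsilon> n" for n x
    have X_lim: "(\<lambda>n. X n x) \<longlonglongrightarrow> \<sigma> * a x" for x
    proof -
      have "((\<lambda>h. exp (h * \<sigma> * a x)) has_real_derivative \<sigma> * a x) (at 0)"
        by (auto intro!: derivative_eq_intros)
      then have "((\<lambda>h. (exp (h * \<sigma> * a x) - 1) / h) \<longlongrightarrow> \<sigma> * a x) (at 0)"
        by (simp add: DERIV_def)
      moreover have "filterlim \<epsilon> (at 0) sequentially"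
        using \<epsilon>_lim \<epsilon>(1) by (auto simp: filterlim_at less_le intro!: always_eventually)
      ultimately show ?thesis
        unfolding X_def by (rule filterlim_compose)
    qed
    have X_bound: "norm (X n x) \<le> w x" for n x
    proof -
      have "\<bar>exp (\<epsilon> n * \<sigma> * a x) - 1\<bar> \<le> \<epsilon> n * \<bar>a x\<bar> * exp (\<epsilon> n * \<bar>a x\<bar>)"
        using exp_diff[of "\<epsilon> n * \<sigma> * a x"] \<epsilon>(1)[of n] \<sigma> by (simp add: abs_mult)
      then have "norm (X n x) \<le> \<bar>a x\<bar> * exp (\<epsilon> n * \<bar>a x\<bar>)"
        using \<epsilon>(1)[of n] by (simp add: X_def field_simps)
      also have "\<dots> \<le> \<bar>a x\<bar> * exp (\<delta> / 2 * \<bar>a x\<bar>)"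
        using mult_right_mono[OF \<epsilon>(2)[of n], of "\<bar>a x\<bar>"] by (intro mult_left_mono) auto
      finally show ?thesis using w_bound[of x] by simp
    qed
    have "(\<lambda>n. \<integral>x. X n x \<partial>M) \<longlonglongrightarrow> (\<integral>x. \<sigma> * a x \<partial>M)"
      by (rule integral_dominated_convergence[where w = w])
        (use w_int X_lim X_bound in \<open>auto simp: X_def[abs_def]\<close>)
    moreover have "0 \<le> (\<integral>x. X n x \<partial>M)" for n
    proof -
      have e: "\<bar>\<epsilon> n * \<sigma>\<bar> \<le> \<delta>"
        using \<epsilon>[of n] \<sigma> by (simp add: abs_mult)
      have "(\<integral>x. X n x \<partial>M) = ((\<integral>x. exp (\<epsilon> n * \<sigma> * a x) \<partial>M) - (\<integral>x. 1 \<partial>M)) / \<epsilon> n"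
        using int[OF e] int[of 0] \<open>\<delta> > 0\<close> by (simp add: X_def)
      then show ?thesis
        using min[OF e] \<epsilon>(1)[of n] by simp
    qed
    ultimately have "0 \<le> (\<integral>x. \<sigma> * a x \<partial>M)"
      by (intro LIMSEQ_le_const) auto
    then show ?thesis by simp
  qed
  show "(\<integral>x. a x \<partial>M) = 0"
    using one_sided[of 1] one_sided[of "-1"] by simp
qed

section \<open>The polar of a shifted function\<close>

lemma s_polar_shift:
  "s_polar s (shift f z) y = (INF x\<in>supp f. ennreal (max (1 - (x - z) \<bullet> y) 0 powr s / f x))"
proof -
  have "supp (shift f z) = (\<lambda>x. x - z) ` supp f"
    by (auto simp: supp_def shift_def intro!: image_eqI[of _ "\<lambda>x. x - z" "_ + z"])
  then show ?thesis
    by (simp add: s_polar_def image_image shift_def)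
qed

text \<open>
  The infimum is over an uncountable set, but it is one of continuous functions and so upper
  semicontinuous.
\<close>
lemma borel_measurable_s_polar [measurable]:
  fixes g :: "'a::euclidean_space \<Rightarrow> real"
  assumes "s > 0"
  shows "s_polar s g \<in> borel_measurable borel"
proof (rule borel_measurableI_less)
  fix c :: ennreal
  have "open {y. ennreal (max (1 - x \<bullet> y) 0 powr s / g x) < c}" for x
  proof -
    have "continuous_on UNIV (\<lambda>y. max (1 - x \<bullet> y) 0 powr s)"
      using assms by (intro continuous_on_powr' continuous_intros) auto
    then have "continuous_on UNIV (\<lambda>y. max (1 - x \<bullet> y) 0 powr s / g x)"
      unfolding divide_inverse by (rule continuous_on_mult_right)
    then show ?thesis
      by (intro open_Collect_less continuous_on_ennreal continuous_on_const)
  qed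
  then have "open (\<Union>x\<in>supp g. {y. ennreal (max (1 - x \<bullet> y) 0 powr s / g x) < c})"
    by blast
  also have "(\<Union>x\<in>supp g. {y. ennreal (max (1 - x \<bullet> y) 0 powr s / g x) < c}) = {y. s_polar s g y < c}"
    by (auto simp: s_polar_def INF_less_iff)
  finally show "{y \<in> space borel. s_polar s g y < c} \<in> sets borel"
    by simp
qed

section \<open>Integrable functions with a concave power\<close>

text \<open>
  All bounds below start from an interior point of the support; without one, neither \<open>f\<close> nor its
  support needs to be bounded.
\<close>
locale concave_power =
  fixes s :: real and f :: "'a::euclidean_space \<Rightarrow> real"
  assumes s_pos: "s > 0"
    and f_nonneg: "\<And>x. f x \<ge> 0"
    and f_concave: "concave_on (supp f) (\<lambda>x. f x powr (1 / s))"
    and f_integrable: "integrable lborel f"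
    and interior_supp: "interior (supp f) \<noteq> {}"
begin

lemma convex_supp: "convex (supp f)"
  using f_concave by (rule concave_on_imp_convex)

lemma supp_nonempty: "supp f \<noteq> {}"
  using interior_supp interior_subset by fastforce

lemma supp_pos: "x \<in> supp f \<Longrightarrow> f x > 0"
  by (simp add: supp_def)

lemma f_eq_power: "f x = (f x powr (1 / s)) powr s"
  using s_pos f_nonneg[of x] by (simp add: powr_powr)

lemma ball_lower_bound:
  assumes "a \<in> interior (supp f)"
  obtains r c where "r > 0" "c > 0" "ball a r \<subseteq> supp f" "\<And>x. x \<in> ball a r \<Longrightarrow> c \<le> f x"
proof -
  let ?g = "\<lambda>x. f x powr (1 / s)"
  have "concave_on (interior (supp f)) ?g"
    using f_concave interior_subset convex_interior[OF convex_supp]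
    by (auto simp: concave_on_def intro: convex_on_subset)
  then have "continuous_on (interior (supp f)) (\<lambda>x. - ?g x)"
    unfolding concave_on_def by (intro convex_on_continuous) auto
  then have "continuous_on (interior (supp f)) ?g"
    using continuous_on_minus by fastforce
  then have cont: "isCont ?g a"
    using assms by (simp add: continuous_on_eq_continuous_at)
  have "?g a > 0"
    using assms interior_subset supp_pos by fastforce
  then have "\<forall>\<^sub>F x in at a. ?g a / 2 < ?g x"
    using cont by (intro order_tendstoD(1)[of ?g "?g a"]) (auto simp: isCont_def)
  then have "\<forall>\<^sub>F x in nhds a. ?g a / 2 < ?g x"
    using \<open>?g a > 0\<close> by (simp add: eventually_at_filter eventually_mono) (auto elim: eventually_mono)
  then obtain r1 where r1: "r1 > 0" "\<And>x. dist x a < r1 \<Longrightarrow> ?g a / 2 < ?g x"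
    by (auto simp: eventually_nhds_metric)
  obtain r2 where r2: "r2 > 0" "ball a r2 \<subseteq> supp f"
    using assms by (meson mem_interior)
  show ?thesis
  proof (rule that[of "min r1 r2" "(?g a / 2) powr s"])
    fix x assume "x \<in> ball a (min r1 r2)"
    then have "?g a / 2 \<le> ?g x"
      using r1(2)[of x] by (simp add: dist_commute)
    then have "(?g a / 2) powr s \<le> ?g x powr s"
      using \<open>?g a > 0\<close> s_pos by (intro powr_mono2) auto
    then show "(?g a / 2) powr s \<le> f x"
      using f_eq_power[of x] by simp
  qed (use r1 r2 \<open>?g a > 0\<close> in auto)
qed

lemma f_borel [measurable]: "f \<in> borel_measurable borel"
  using f_integrable by auto

text \<open>
  The support itself is not known to have finite volume, but a superlevel set at a positive level
  has, by integrability. By concavity \<open>f\<^bsup>1/s\<^esup>\<close> has at least half of its value at a fixed interior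
  point \<open>a\<close> in every midpoint of \<open>a\<close> and a point of the support, so an unbounded support would give
  an unbounded superlevel set.
\<close>
lemma bounded_supp: "bounded (supp f)"
proof -
  let ?g = "\<lambda>x. f x powr (1 / s)"
  obtain a where a: "a \<in> interior (supp f)"
    using interior_supp by auto
  obtain r c where rc: "r > 0" "c > 0" "ball a r \<subseteq> supp f" "\<And>x. x \<in> ball a r \<Longrightarrow> c \<le> f x"
    using ball_lower_bound[OF a] by metis
  define h where "h = c powr (1 / s) / 2"
  have "h > 0" using rc by (simp add: h_def)
  have g_ball: "2 * h \<le> ?g x" if "x \<in> ball a r" for x
    using rc(4)[OF that] rc(2) s_pos by (auto simp: h_def intro!: powr_mono2)
  define L where "L = {x. h \<le> ?g x}"
  have L_supp: "L \<subseteq> supp f"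
    using \<open>h > 0\<close> f_nonneg by (auto simp: L_def supp_def less_le)
  have "convex L"
  proof (rule convexI)
    fix x y and u v :: real assume xy: "x \<in> L" "y \<in> L" and uv: "0 \<le> u" "0 \<le> v" "u + v = 1"
    have "h = u * h + v * h"
      using uv by (metis distrib_right mult_1)
    also have "\<dots> \<le> u * ?g x + v * ?g y"
      using xy uv by (intro add_mono mult_left_mono) (auto simp: L_def)
    also have "\<dots> \<le> ?g (u *\<^sub>R x + v *\<^sub>R y)"
      using f_concave xy L_supp uv unfolding concave_on_iff by blast
    finally show "u *\<^sub>R x + v *\<^sub>R y \<in> L"
      by (simp add: L_def)
  qed
  moreover have L_sets: "L \<in> sets borel"
    unfolding L_def by measurable
  moreover have "interior L \<noteq> {}"
  proof -
    have "ball a r \<subseteq> L"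
      using g_ball \<open>h > 0\<close> by (force simp: L_def)
    then have "a \<in> interior L"
      using rc(1) by (meson mem_interior)
    then show ?thesis by auto
  qed
  moreover have "emeasure lborel L < \<infinity>"
  proof -
    have "ennreal (h powr s) * emeasure lborel L = (\<integral>\<^sup>+x. ennreal (h powr s) * indicator L x \<partial>lborel)"
      using L_sets by (simp add: nn_integral_cmult_indicator)
    also have "\<dots> \<le> (\<integral>\<^sup>+x. ennreal (f x) \<partial>lborel)"
    proof (intro nn_integral_mono)
      fix x :: 'a
      have "h powr s \<le> f x" if "x \<in> L"
        using that \<open>h > 0\<close> s_pos powr_mono2[of s h "?g x"] f_eq_power[of x] by (auto simp: L_def)
      then show "ennreal (h powr s) * indicator L x \<le> ennreal (f x)"
        by (auto simp: indicator_def intro!: ennreal_leI)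
    qed
    also have "\<dots> < \<infinity>"
      using f_integrable f_nonneg by (simp add: integrable_iff_bounded)
    finally show ?thesis
      using \<open>h > 0\<close> by (auto simp: ennreal_mult_less_top)
  qed
  ultimately have "bounded L"
    by (rule convex_finite_measure_bounded)
  then obtain B where B: "\<And>x. x \<in> L \<Longrightarrow> dist a x \<le> B"
    by (meson bounded_any_center)
  have "dist a x \<le> 2 * B" if x: "x \<in> supp f" for x
  proof -
    let ?y = "(1/2) *\<^sub>R a + (1/2) *\<^sub>R x"
    have "a \<in> supp f"
      using a interior_subset by blast
    with x have "(1/2) * ?g a + (1/2) * ?g x \<le> ?g ?y"
      using f_concave unfolding concave_on_iff by (metis field_sum_of_halves half_gt_zero_iff less_eq_real_def zero_less_one)
    moreover have "2 * h \<le> ?g a" using g_ball rc(1) by simp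
    moreover have "0 \<le> ?g x" by simp
    ultimately have "h \<le> ?g ?y" by linarith
    then have "?y \<in> L" by (simp add: L_def)
    then have "dist a ?y \<le> B" by (rule B)
    moreover have "a - ?y = (1/2) *\<^sub>R (a - x)"
      by (simp add: algebra_simps flip: scaleR_add_left)
    then have "dist a ?y = dist a x / 2"
      by (simp add: dist_norm)
    ultimately show ?thesis by simp
  qed
  then show ?thesis
    by (meson bounded_any_center)
qed

text \<open>
  Reflect \<open>x\<close> in an interior point \<open>a\<close>, scaled down by a factor \<open>\<rho>\<close> so that the image \<open>y\<close> stays in
  the support. As \<open>a\<close> lies between \<open>x\<close> and \<open>y\<close>, concavity bounds the value at \<open>x\<close> by the one at \<open>a\<close>.
\<close>
lemma f_upper_bound:
  obtains M where "M > 0" "\<And>x. f x \<le> M"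
proof -
  let ?g = "\<lambda>x. f x powr (1 / s)"
  obtain a where a: "a \<in> interior (supp f)"
    using interior_supp by auto
  obtain r where r: "r > 0" "ball a r \<subseteq> supp f"
    using a by (meson mem_interior)
  obtain D where D: "D > 0" "\<And>x. x \<in> supp f \<Longrightarrow> dist a x \<le> D"
    using bounded_supp by (metis bounded_any_center dual_order.trans linorder_not_le max.cobounded1 max.strict_coboundedI2 zero_less_one max_def)
  define \<rho> where "\<rho> = r / (2 * D)"
  have "\<rho> > 0" using r D by (simp add: \<rho>_def)
  have g_bound: "?g x \<le> (1 + \<rho>) / \<rho> * ?g a" if x: "x \<in> supp f" for x
  proof -
    define y where "y = a - \<rho> *\<^sub>R (x - a)"
    have "dist a y = \<rho> * dist a x"
      using \<open>\<rho> > 0\<close> by (simp add: y_def dist_norm norm_minus_commute)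
    also have "\<dots> \<le> \<rho> * D"
      using D(2)[OF x] \<open>\<rho> > 0\<close> by simp
    also have "\<dots> < r"
      using D r by (simp add: \<rho>_def)
    finally have "y \<in> supp f"
      using r by auto
    moreover have "(1 / (1 + \<rho>)) *\<^sub>R y + (\<rho> / (1 + \<rho>)) *\<^sub>R x = a"
    proof -
      have "(1 / (1 + \<rho>)) *\<^sub>R y + (\<rho> / (1 + \<rho>)) *\<^sub>R x = (1 / (1 + \<rho>)) *\<^sub>R (y + \<rho> *\<^sub>R x)"
        by (simp add: scaleR_add_right)
      also have "y + \<rho> *\<^sub>R x = (1 + \<rho>) *\<^sub>R a"
        by (simp add: y_def algebra_simps)
      finally show ?thesis using \<open>\<rho> > 0\<close> by simp
    qed
    moreover have "1 / (1 + \<rho>) + \<rho> / (1 + \<rho>) = 1"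
      using \<open>\<rho> > 0\<close> by (simp add: field_simps)
    ultimately have "1 / (1 + \<rho>) * ?g y + \<rho> / (1 + \<rho>) * ?g x \<le> ?g a"
      using f_concave x \<open>\<rho> > 0\<close> unfolding concave_on_iff
      by (metis add_pos_pos divide_nonneg_pos less_eq_real_def zero_le_one zero_less_one)
    moreover have "0 \<le> 1 / (1 + \<rho>) * ?g y"
      using \<open>\<rho> > 0\<close> by simp
    ultimately have "\<rho> / (1 + \<rho>) * ?g x \<le> ?g a" by linarith
    then show ?thesis
      using \<open>\<rho> > 0\<close> by (simp add: field_simps)
  qed
  let ?M = "((1 + \<rho>) / \<rho> * ?g a) powr s"
  have "f x \<le> max 1 ?M" for x
  proof (cases "x \<in> supp f")
    case True
    have "f x = ?g x powr s" by (rule f_eq_power)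
    also have "\<dots> \<le> ?M"
      using g_bound[OF True] s_pos by (intro powr_mono2) auto
    finally show ?thesis by simp
  next
    case False
    then show ?thesis by (simp add: supp_def not_less)
  qed
  then show ?thesis
    by (intro that[of "max 1 ?M"]) auto
qed

section \<open>Positivity and finiteness of the polar integral\<close>

text \<open>
  Half of the polar of the shifted support. The factor keeps the numerator in the definition of the
  \<open>s\<close>-polar away from zero.
\<close>
definition polar_body :: "'a \<Rightarrow> 'a set" where
  "polar_body z = {y. \<forall>x\<in>supp f. (x - z) \<bullet> y \<le> 1 / 2}"

lemma polar_body_eq_INT: "polar_body z = (\<Inter>x\<in>supp f. {y. (x - z) \<bullet> y \<le> 1 / 2})"
  by (auto simp: polar_body_def)

lemma closed_polar_body: "closed (polar_body z)"
  unfolding polar_body_eq_INT by (intro closed_INT ballI closed_halfspace_le)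

lemma convex_polar_body: "convex (polar_body z)"
  unfolding polar_body_eq_INT by (intro convex_INT convex_halfspace_le)

lemma sets_polar_body [measurable, simp]: "polar_body z \<in> sets borel"
  using closed_polar_body by simp

lemma s_polar_ge_on_polar_body:
  assumes M: "M > 0" "\<And>x. f x \<le> M" and y: "\<And>x. x \<in> supp f \<Longrightarrow> (x - z) \<bullet> y \<le> 1 / 2"
  shows "ennreal ((1 / 2) powr s / M) \<le> s_polar s (shift f z) y"
  unfolding s_polar_shift
proof (intro INF_greatest ennreal_leI)
  fix x assume x: "x \<in> supp f"
  show "(1 / 2) powr s / M \<le> max (1 - (x - z) \<bullet> y) 0 powr s / f x"
  proof (rule frac_le)
    show "(1 / 2) powr s \<le> max (1 - (x - z) \<bullet> y) 0 powr s"
      using y[OF x] s_pos by (intro powr_mono2) auto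
  qed (use M supp_pos[OF x] in auto)
qed

lemma polar_integral_ge_polar_body:
  obtains c where "c > 0"
    "\<And>z. ennreal c * emeasure lborel (polar_body z) \<le> polar_integral s f z"
proof -
  obtain M where M: "M > 0" "\<And>x. f x \<le> M"
    using f_upper_bound by blast
  show ?thesis
  proof (rule that[of "(1 / 2) powr s / M"])
    fix z :: 'a
    have "ennreal ((1 / 2) powr s / M) * emeasure lborel (polar_body z)
        = (\<integral>\<^sup>+y. ennreal ((1 / 2) powr s / M) * indicator (polar_body z) y \<partial>lborel)"
      by (simp add: nn_integral_cmult_indicator)
    also have "\<dots> \<le> polar_integral s f z"
      unfolding polar_integral_def
      by (intro nn_integral_mono) (use s_polar_ge_on_polar_body[OF M] in \<open>auto simp: indicator_def polar_body_def\<close>)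
    finally show "ennreal ((1 / 2) powr s / M) * emeasure lborel (polar_body z) \<le> polar_integral s f z" .
  qed (use M in simp)
qed

lemma polar_body_contains_ball:
  obtains \<rho> where "\<rho> > 0" "ball 0 \<rho> \<subseteq> polar_body z"
proof -
  obtain D where D: "\<And>x. x \<in> supp f \<Longrightarrow> dist z x \<le> D"
    using bounded_supp by (meson bounded_any_center)
  define R where "R = max D 1"
  have "(x - z) \<bullet> y \<le> 1 / 2" if "x \<in> supp f" "y \<in> ball 0 (1 / (2 * R))" for x y
  proof -
    have "(x - z) \<bullet> y \<le> norm (x - z) * norm y"
      by (rule norm_cauchy_schwarz)
    also have "\<dots> \<le> R * (1 / (2 * R))"
      using D[OF that(1)] that(2) by (intro mult_mono) (auto simp: R_def dist_norm norm_minus_commute)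
    also have "\<dots> = 1 / 2" by (simp add: R_def)
    finally show ?thesis .
  qed
  then show ?thesis
    by (intro that[of "1 / (2 * R)"]) (auto simp: R_def polar_body_def)
qed

lemma polar_integral_pos: "0 < polar_integral s f z"
proof -
  obtain c where c: "c > 0" "ennreal c * emeasure lborel (polar_body z) \<le> polar_integral s f z"
    using polar_integral_ge_polar_body by metis
  obtain \<rho> where \<rho>: "\<rho> > 0" "ball 0 \<rho> \<subseteq> polar_body z"
    using polar_body_contains_ball by blast
  have "0 < emeasure lborel (ball (0::'a) \<rho>)"
    using content_ball_pos[OF \<rho>(1), of "0::'a"] by (simp add: measure_def enn2real_positive_iff)
  also have "\<dots> \<le> emeasure lborel (polar_body z)"
    using \<rho>(2) closed_polar_body by (intro emeasure_mono) auto
  finally have "0 < ennreal c * emeasure lborel (polar_body z)"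
    using c(1) by (simp add: ennreal_zero_less_mult_iff)
  then show ?thesis using c(2) by simp
qed

text \<open>
  The normal of a hyperplane separating \<open>z\<close> from the support spans a ray in the polar body. So this
  convex set is unbounded, and as it is a neighbourhood of \<open>0\<close>, its volume is infinite.
\<close>
lemma polar_integral_outside_interior:
  assumes z: "z \<notin> interior (supp f)"
  shows "polar_integral s f z = \<infinity>"
proof -
  obtain n b where n: "n \<noteq> 0" "\<And>x. x \<in> interior (supp f) \<Longrightarrow> n \<bullet> x \<le> b" "n \<bullet> z \<ge> b"
    using separating_hyperplane_sets[of "interior (supp f)" "{z}"] z interior_supp convex_supp
    by (auto simp: convex_interior)
  have "closure (interior (supp f)) \<subseteq> {x. n \<bullet> x \<le> b}"
    using n(2) by (intro closure_minimal closed_halfspace_le) auto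
  then have "supp f \<subseteq> {x. n \<bullet> x \<le> b}"
    using convex_closure_interior[OF convex_supp interior_supp] closure_subset[of "supp f"] by simp
  then have n_supp: "n \<bullet> x \<le> n \<bullet> z" if "x \<in> supp f" for x
    using that n(3) by (auto intro: order_trans)
  have "interior (polar_body z) \<noteq> {}"
  proof -
    obtain \<rho> where \<rho>: "\<rho> > 0" "ball 0 \<rho> \<subseteq> polar_body z"
      using polar_body_contains_ball by blast
    then have "0 \<in> interior (polar_body z)"
      by (meson mem_interior)
    then show ?thesis by blast
  qed
  moreover have "\<not> bounded (polar_body z)"
  proof
    assume "bounded (polar_body z)"
    then obtain B where B: "\<And>y. y \<in> polar_body z \<Longrightarrow> norm y \<le> B"
      by (auto simp: bounded_iff)
    have ray: "t *\<^sub>R n \<in> polar_body z" if "t \<ge> 0" for t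
    proof -
      have "(x - z) \<bullet> n \<le> 0" if "x \<in> supp f" for x
        using n_supp[OF that] by (simp add: inner_commute[of _ n] inner_diff_right)
      then have "t * ((x - z) \<bullet> n) \<le> 0" if "x \<in> supp f" for x
        using that \<open>t \<ge> 0\<close> by (simp add: mult_nonneg_nonpos)
      then show ?thesis by (force simp: polar_body_def intro: order_trans)
    qed
    have "norm (((\<bar>B\<bar> + 1) / norm n) *\<^sub>R n) \<le> B"
      by (intro B ray) simp
    then show False using n(1) by simp
  qed
  ultimately have "emeasure lborel (polar_body z) = \<infinity>"
    using convex_finite_measure_bounded[OF convex_polar_body sets_polar_body]
    by (metis infinity_ennreal_def less_top)
  moreover obtain c where "c > 0" "ennreal c * emeasure lborel (polar_body z) \<le> polar_integral s f z"
    using polar_integral_ge_polar_body by metis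
  ultimately show ?thesis
    by (simp add: ennreal_mult_top top_unique)
qed

text \<open>
  For given \<open>y\<close>, test the infimum with the point at distance \<open>r / 2\<close> from \<open>z\<close> in the direction of
  \<open>y\<close>; its numerator vanishes once \<open>norm y\<close> exceeds \<open>2 / r\<close>.
\<close>
lemma s_polar_compact_support:
  assumes "z \<in> interior (supp f)"
  obtains B R where "\<And>y. s_polar s (shift f z) y \<le> ennreal B * indicator (cball 0 R) y" "B \<ge> 0"
proof -
  obtain r c where rc: "r > 0" "c > 0" "ball z r \<subseteq> supp f" "\<And>x. x \<in> ball z r \<Longrightarrow> c \<le> f x"
    using ball_lower_bound[OF assms] by metis
  have "s_polar s (shift f z) y \<le> ennreal (1 / c) * indicator (cball 0 (2 / r)) y" for y
  proof -
    define x where "x = z + (r / 2) *\<^sub>R sgn y"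
    have "dist z x < r"
      using rc(1) by (simp add: x_def dist_norm norm_sgn)
    then have x: "x \<in> supp f" "c \<le> f x" using rc by auto
    have "(x - z) \<bullet> y = r / 2 * norm y"
      by (cases "y = 0") (simp_all add: x_def sgn_div_norm dot_square_norm power2_eq_square)
    then have le: "s_polar s (shift f z) y \<le> ennreal (max (1 - r / 2 * norm y) 0 powr s / f x)"
      unfolding s_polar_shift by (metis (no_types, lifting) INF_lower x(1))
    show ?thesis
    proof (cases "norm y \<le> 2 / r")
      case True
      have "max (1 - r / 2 * norm y) 0 powr s \<le> 1 powr s"
        using rc(1) s_pos by (intro powr_mono2) auto
      then have "max (1 - r / 2 * norm y) 0 powr s / f x \<le> 1 / c"
        using x rc(2) by (intro frac_le) auto
      with le True show ?thesis
        by (auto intro: order_trans ennreal_leI)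
    next
      case False
      then have "max (1 - r / 2 * norm y) 0 = 0"
        using rc(1) by (simp add: field_simps max_def)
      with le False show ?thesis by simp
    qed
  qed
  then show ?thesis
    using rc(2) by (intro that[of "1 / c" "2 / r"]) auto
qed

lemma polar_integral_finite:
  assumes "z \<in> interior (supp f)"
  shows "polar_integral s f z < \<infinity>"
proof -
  obtain B R where BR: "\<And>y. s_polar s (shift f z) y \<le> ennreal B * indicator (cball 0 R) y"
    using s_polar_compact_support[OF assms] by metis
  have "polar_integral s f z \<le> (\<integral>\<^sup>+(y :: 'a). ennreal B * indicator (cball 0 R) y \<partial>lborel)"
    unfolding polar_integral_def by (intro nn_integral_mono BR)
  also have "\<dots> < \<infinity>"
    using emeasure_lborel_cball_finite[of "0::'a" R]
    by (simp add: nn_integral_cmult_indicator ennreal_mult_less_top)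
  finally show ?thesis .
qed

section \<open>The polar as a sublevel set of a gauge\<close>

text \<open>
  After the substitution \<open>\<lambda> = \<rho>\<^sup>s\<close> this is the support function of the hypograph of the concave
  function \<open>f\<^bsup>1/s\<^esup>\<close>. Only positive \<open>\<lambda>\<close> are of interest; the absolute value keeps the
  root continuous and homogeneous on the whole space.
\<close>
definition hypograph_support :: "'a \<times> real \<Rightarrow> real" where
  "hypograph_support p = (SUP x\<in>supp f. x \<bullet> fst p + (\<bar>snd p\<bar> * f x) powr (1 / s))"

definition polar_gauge :: "'a \<Rightarrow> 'a \<times> real \<Rightarrow> real" where
  "polar_gauge z p = hypograph_support p - z \<bullet> fst p"

lemma hypograph_support_bdd:
  "bdd_above ((\<lambda>x. x \<bullet> fst p + (\<bar>snd p\<bar> * f x) powr (1 / s)) ` supp f)"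
proof -
  obtain B where B: "\<And>x. x \<in> supp f \<Longrightarrow> norm x \<le> B"
    using bounded_supp by (auto simp: bounded_iff)
  obtain M where M: "M > 0" "\<And>x. f x \<le> M"
    using f_upper_bound by blast
  show ?thesis
  proof (rule bdd_aboveI2)
    fix x assume x: "x \<in> supp f"
    have "x \<bullet> fst p \<le> norm x * norm (fst p)"
      by (rule norm_cauchy_schwarz)
    also have "\<dots> \<le> B * norm (fst p)"
      using B[OF x] by (intro mult_right_mono) auto
    finally show "x \<bullet> fst p + (\<bar>snd p\<bar> * f x) powr (1 / s)
        \<le> B * norm (fst p) + (\<bar>snd p\<bar> * M) powr (1 / s)"
      using M f_nonneg s_pos by (intro add_mono powr_mono2 mult_left_mono) auto
  qed
qed

lemma hypograph_support_le_iff: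
  "hypograph_support p \<le> c \<longleftrightarrow> (\<forall>x\<in>supp f. x \<bullet> fst p + (\<bar>snd p\<bar> * f x) powr (1 / s) \<le> c)"
  unfolding hypograph_support_def by (rule cSUP_le_iff[OF supp_nonempty hypograph_support_bdd])

lemma hypograph_support_upper:
  "x \<in> supp f \<Longrightarrow> x \<bullet> fst p + (\<bar>snd p\<bar> * f x) powr (1 / s) \<le> hypograph_support p"
  using hypograph_support_le_iff by blast

lemma hypograph_support_scale:
  assumes "t > 0"
  shows "hypograph_support (t *\<^sub>R v, t powr s * l) = t * hypograph_support (v, l)"
proof -
  have le: "hypograph_support (t *\<^sub>R v, t powr s * l) \<le> t * hypograph_support (v, l)" if "t > 0" for t v l
    unfolding hypograph_support_le_iff
  proof
    fix x assume x: "x \<in> supp f"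
    have "(\<bar>t powr s * l\<bar> * f x) powr (1 / s) = t * (\<bar>l\<bar> * f x) powr (1 / s)"
      using that f_nonneg[of x] s_pos by (simp add: abs_mult powr_mult powr_powr)
    then have "x \<bullet> fst (t *\<^sub>R v, t powr s * l) + (\<bar>snd (t *\<^sub>R v, t powr s * l)\<bar> * f x) powr (1 / s) =
        t * (x \<bullet> v + (\<bar>l\<bar> * f x) powr (1 / s))"
      by (simp add: distrib_left)
    also have "\<dots> \<le> t * hypograph_support (v, l)"
      using hypograph_support_upper[OF x, of "(v, l)"] that by (intro mult_left_mono) auto
    finally show "x \<bullet> fst (t *\<^sub>R v, t powr s * l) + (\<bar>snd (t *\<^sub>R v, t powr s * l)\<bar> * f x) powr (1 / s)
        \<le> t * hypograph_support (v, l)" .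
  qed
  have "hypograph_support (v, l) \<le> (1 / t) * hypograph_support (t *\<^sub>R v, t powr s * l)"
    using le[of "1 / t" "t *\<^sub>R v" "t powr s * l"] assms
    by (simp add: powr_divide)
  then show ?thesis
    using le[OF assms, of v l] assms by (simp add: field_simps)
qed

lemma polar_gauge_scale:
  "t > 0 \<Longrightarrow> polar_gauge z (t *\<^sub>R v, t powr s * l) = t * polar_gauge z (v, l)"
  by (simp add: polar_gauge_def hypograph_support_scale right_diff_distrib)

text \<open>
  As a supremum of continuous functions it is lower semicontinuous.
\<close>
lemma hypograph_support_borel [measurable]: "hypograph_support \<in> borel_measurable borel"
proof (rule borel_measurableI_greater)
  fix c :: real
  have "continuous_on UNIV (\<lambda>p :: 'a \<times> real. x \<bullet> fst p + (\<bar>snd p\<bar> * f x) powr (1 / s))" for x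
    using s_pos f_nonneg by (intro continuous_intros continuous_on_powr') auto
  then have "open (\<Union>x\<in>supp f. {p. c < x \<bullet> fst p + (\<bar>snd p\<bar> * f x) powr (1 / s)})"
    by (intro open_UN ballI open_Collect_less continuous_on_const) auto
  also have "(\<Union>x\<in>supp f. {p. c < x \<bullet> fst p + (\<bar>snd p\<bar> * f x) powr (1 / s)}) =
      {p. c < hypograph_support p}"
    using hypograph_support_le_iff by (auto simp: not_le[symmetric])
  finally show "{p \<in> space borel. c < hypograph_support p} \<in> sets borel"
    by simp
qed

lemma polar_gauge_borel [measurable]: "polar_gauge z \<in> borel_measurable borel"
  unfolding polar_gauge_def[abs_def] by measurable

lemma polar_gauge_nonneg:
  assumes "z \<in> closure (supp f)"
  shows "0 \<le> polar_gauge z p"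
proof -
  have "x \<bullet> fst p \<le> hypograph_support p" if "x \<in> supp f" for x
    using hypograph_support_upper[OF that, of p] powr_ge_zero[of "\<bar>snd p\<bar> * f x" "1 / s"] by linarith
  then have "supp f \<subseteq> {x. fst p \<bullet> x \<le> hypograph_support p}"
    by (auto simp: inner_commute)
  then have "closure (supp f) \<subseteq> {x. fst p \<bullet> x \<le> hypograph_support p}"
    by (intro closure_minimal closed_halfspace_le)
  then show ?thesis
    using assms by (auto simp: polar_gauge_def inner_commute)
qed

text \<open>
  The key link: taking \<open>s\<close>-th roots makes the condition that \<open>l\<close> is at most the polar linear in \<open>z\<close>.
\<close>
lemma polar_gauge_le_1_iff:
  assumes "l > 0"
  shows "polar_gauge z (v, l) \<le> 1 \<longleftrightarrow> ennreal l \<le> s_polar s (shift f z) v"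
proof -
  have root_le: "a powr (1 / s) \<le> b \<longleftrightarrow> a \<le> max b 0 powr s" if "a > 0" for a b :: real
  proof
    assume "a powr (1 / s) \<le> b"
    then have "(a powr (1 / s)) powr s \<le> max b 0 powr s"
      using s_pos by (intro powr_mono2) auto
    then show "a \<le> max b 0 powr s"
      using that s_pos by (simp add: powr_powr)
  next
    assume *: "a \<le> max b 0 powr s"
    then have "max b 0 > 0"
      using that s_pos by (cases "max b 0 = 0") auto
    moreover have "a powr (1 / s) \<le> (max b 0 powr s) powr (1 / s)"
      using that s_pos * by (intro powr_mono2) auto
    ultimately show "a powr (1 / s) \<le> b"
      using s_pos by (simp add: powr_powr max_def split: if_splits)
  qed
  have "polar_gauge z (v, l) \<le> 1 \<longleftrightarrow> hypograph_support (v, l) \<le> 1 + z \<bullet> v"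
    by (auto simp: polar_gauge_def)
  also have "\<dots> \<longleftrightarrow> (\<forall>x\<in>supp f. (l * f x) powr (1 / s) \<le> 1 - (x - z) \<bullet> v)"
    using assms by (auto simp: hypograph_support_le_iff inner_diff_left algebra_simps)
  also have "\<dots> \<longleftrightarrow> (\<forall>x\<in>supp f. l \<le> max (1 - (x - z) \<bullet> v) 0 powr s / f x)"
    using assms supp_pos by (intro ball_cong refl) (simp add: root_le pos_le_divide_eq)
  also have "\<dots> \<longleftrightarrow> ennreal l \<le> s_polar s (shift f z) v"
    unfolding s_polar_shift le_INF_iff using supp_pos
    by (intro ball_cong refl) (simp add: ennreal_le_iff less_imp_le)
  finally show ?thesis .
qed

lemma s_polar_finite: "s_polar s (shift f z) y < \<infinity>"
proof -
  obtain x where x: "x \<in> supp f" using supp_nonempty by blast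
  then have "s_polar s (shift f z) y \<le> ennreal (max (1 - (x - z) \<bullet> y) 0 powr s / f x)"
    unfolding s_polar_shift by (metis (no_types, lifting) INF_lower)
  then show ?thesis by (simp add: order_le_less_trans)
qed

text \<open>
  By the previous equivalence, integrating the indicator of \<open>{G\<^sub>z \<le> 1}\<close> over \<open>\<lambda> > 0\<close> yields the polar.
  The weight is \<open>q = 1\<close> with \<open>k = 0\<close> for the polar integral, and the positive or negative part of a
  coordinate with \<open>k = 1\<close> for the barycenter. Points outside the closure of the support have to be
  excluded because their gauge takes negative values.
\<close>
lemma polar_moment_laplace:
  assumes z: "z \<in> closure (supp f)" and [measurable]: "q \<in> borel_measurable borel"
    and q_scale: "\<And>t v. t > 0 \<Longrightarrow> q (t *\<^sub>R v) = ennreal (t powr k) * q v" and "k \<ge> 0"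
  shows "(\<integral>\<^sup>+p. q (fst p) * indicator {p. 0 < snd p} p * ennreal (exp (- polar_gauge z p)) \<partial>lborel) =
    ennreal (Gamma (real DIM('a) + s + k + 1)) * (\<integral>\<^sup>+y. q y * s_polar s (shift f z) y \<partial>lborel)"
proof -
  let ?q = "\<lambda>p :: 'a \<times> real. q (fst p) * indicator {p. 0 < snd p} p"
  have [measurable]: "polar_gauge z \<in> borel_measurable (borel \<Otimes>\<^sub>M borel)"
    by (simp add: borel_prod)
  have "(\<integral>\<^sup>+p. ?q p * ennreal (exp (- polar_gauge z p)) \<partial>lborel) =
      ennreal (Gamma (real DIM('a) + s + k + 1)) *
      (\<integral>\<^sup>+p. ?q p * indicator {p. polar_gauge z p \<le> 1} p \<partial>lborel)"
  proof (rule nn_integral_exp_quasi_homogeneous)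
    show "?q (t *\<^sub>R v, t powr s * l) = ennreal (t powr k) * ?q (v, l)" if "t > 0" for t v l
      using that q_scale[OF that, of v] by (auto simp: indicator_def zero_less_mult_iff)
  qed (use s_pos \<open>k \<ge> 0\<close> polar_gauge_nonneg[OF z] polar_gauge_scale in auto)
  also have "(\<integral>\<^sup>+p. ?q p * indicator {p. polar_gauge z p \<le> 1} p \<partial>lborel) =
      (\<integral>\<^sup>+v. \<integral>\<^sup>+l. ?q (v, l) * indicator {p. polar_gauge z p \<le> 1} (v, l) \<partial>lborel \<partial>lborel)"
    by (subst lborel_prod[symmetric], rule lborel.nn_integral_fst[symmetric]) measurable
  also have "\<dots> = (\<integral>\<^sup>+y. q y * s_polar s (shift f z) y \<partial>lborel)"
  proof (intro nn_integral_cong)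
    fix v :: 'a
    obtain L where L: "s_polar s (shift f z) v = ennreal L" "L \<ge> 0"
      using s_polar_finite[of z v] by (cases "s_polar s (shift f z) v") auto
    have "(\<integral>\<^sup>+l. ?q (v, l) * indicator {p. polar_gauge z p \<le> 1} (v, l) \<partial>lborel) =
        (\<integral>\<^sup>+l. q v * indicator {0<..L} l \<partial>lborel)"
      using L(2) by (intro nn_integral_cong) (auto simp: indicator_def polar_gauge_le_1_iff L(1))
    also have "\<dots> = q v * ennreal L"
      using L(2) by (simp add: nn_integral_cmult_indicator)
    finally show "(\<integral>\<^sup>+l. ?q (v, l) * indicator {p. polar_gauge z p \<le> 1} (v, l) \<partial>lborel) =
        q v * s_polar s (shift f z) v"
      using L by simp
  qed
  finally show ?thesis .
qed

section \<open>Convexity and concavity\<close>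

text \<open>
  The parameter \<open>c\<close> homogenises the Laplace transform; the power concavity of the polar integral
  results from convexity in \<open>(c, c z)\<close> jointly.
\<close>
definition gauge_laplace :: "real \<Rightarrow> 'a \<Rightarrow> ennreal" where
  "gauge_laplace c z =
    (\<integral>\<^sup>+p. indicator {p. 0 < snd p} p * ennreal (exp (- (c * polar_gauge z p))) \<partial>lborel)"

lemma gauge_laplace_polar_integral:
  assumes "z \<in> closure (supp f)"
  shows "gauge_laplace 1 z = ennreal (Gamma (real DIM('a) + s + 1)) * polar_integral s f z"
  using polar_moment_laplace[OF assms, of "\<lambda>_. 1" 0]
  by (simp add: gauge_laplace_def polar_integral_def)

lemma gauge_laplace_scale:
  assumes "c > 0"
  shows "gauge_laplace 1 z = ennreal (c powr (real DIM('a) + s)) * gauge_laplace c z"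
proof -
  have "gauge_laplace 1 z = ennreal (c powr (real DIM('a) + s)) *
      (\<integral>\<^sup>+p. indicator {p. 0 < snd p} (c *\<^sub>R fst p, c powr s * snd p) *
        ennreal (exp (- (1 * polar_gauge z (c *\<^sub>R fst p, c powr s * snd p)))) \<partial>lborel)"
    unfolding gauge_laplace_def
    by (rule nn_integral_lborel_anisotropic_scaling[OF _ assms]) measurable
  also have "(\<integral>\<^sup>+p. indicator {p. 0 < snd p} (c *\<^sub>R fst p, c powr s * snd p) *
        ennreal (exp (- (1 * polar_gauge z (c *\<^sub>R fst p, c powr s * snd p)))) \<partial>lborel) = gauge_laplace c z"
    unfolding gauge_laplace_def using assms
    by (intro nn_integral_cong) (auto simp: polar_gauge_scale indicator_def zero_less_mult_iff)
  finally show ?thesis .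
qed

lemma Gamma_dim_pos: "0 < Gamma (real DIM('a) + s + 1)"
  using s_pos by (intro Gamma_real_pos) linarith

lemma gauge_laplace_eq:
  assumes "z \<in> interior (supp f)" "c > 0"
  shows "gauge_laplace c z = ennreal (Gamma (real DIM('a) + s + 1) *
    (c powr (- (real DIM('a) + s)) * enn2real (polar_integral s f z)))"
proof -
  let ?m = "real DIM('a) + s"
  have "z \<in> closure (supp f)"
    using assms(1) interior_subset closure_subset by blast
  have "gauge_laplace c z = ennreal (c powr (- ?m)) * (ennreal (c powr ?m) * gauge_laplace c z)"
    using assms(2) by (simp add: mult.assoc[symmetric] ennreal_mult'[symmetric] powr_add[symmetric])
  also have "ennreal (c powr ?m) * gauge_laplace c z = ennreal (Gamma (?m + 1)) * polar_integral s f z"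
    unfolding gauge_laplace_scale[OF assms(2), symmetric]
    by (rule gauge_laplace_polar_integral[OF \<open>z \<in> closure (supp f)\<close>])
  also have "polar_integral s f z = ennreal (enn2real (polar_integral s f z))"
    using polar_integral_finite[OF assms(1)] by simp
  finally show ?thesis
    using Gamma_dim_pos by (simp add: ennreal_mult'[symmetric] mult_ac)
qed

text \<open>
  The exponent \<open>c G\<^sub>z = c W - \<langle>c z, v\<rangle>\<close> is linear in \<open>(c, c z)\<close>.
\<close>
lemma gauge_laplace_convex:
  assumes uv: "u \<ge> 0" "v \<ge> 0" "u + v = 1"
    and c: "c = u * c1 + v * c2" and z: "c *\<^sub>R z = (u * c1) *\<^sub>R a + (v * c2) *\<^sub>R b"
  shows "gauge_laplace c z \<le> ennreal u * gauge_laplace c1 a + ennreal v * gauge_laplace c2 b"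
proof -
  have "exp (- (c * polar_gauge z p)) \<le>
      u * exp (- (c1 * polar_gauge a p)) + v * exp (- (c2 * polar_gauge b p))" for p
  proof -
    have zc: "c * (z \<bullet> fst p) = u * c1 * (a \<bullet> fst p) + v * c2 * (b \<bullet> fst p)"
      using arg_cong[OF z, of "\<lambda>x. x \<bullet> fst p"] by (simp add: inner_add_left)
    have "c * polar_gauge z p = c * hypograph_support p - c * (z \<bullet> fst p)"
      by (simp add: polar_gauge_def right_diff_distrib)
    also have "\<dots> = u * (c1 * polar_gauge a p) + v * (c2 * polar_gauge b p)"
      unfolding zc unfolding c by (simp add: polar_gauge_def algebra_simps)
    finally have "- (c * polar_gauge z p) = u *\<^sub>R (- (c1 * polar_gauge a p)) + v *\<^sub>R (- (c2 * polar_gauge b p))"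
      by simp
    then show ?thesis
      using exp_convex uv unfolding convex_on_def by (metis UNIV_I)
  qed
  then have "gauge_laplace c z \<le> (\<integral>\<^sup>+p.
      ennreal u * (indicator {p. 0 < snd p} p * ennreal (exp (- (c1 * polar_gauge a p)))) +
      ennreal v * (indicator {p. 0 < snd p} p * ennreal (exp (- (c2 * polar_gauge b p)))) \<partial>lborel)"
    unfolding gauge_laplace_def using uv
    by (intro nn_integral_mono) (auto simp: indicator_def ennreal_mult'[symmetric] ennreal_plus[symmetric] simp del: ennreal_plus intro!: ennreal_leI)
  also have "\<dots> = ennreal u * gauge_laplace c1 a + ennreal v * gauge_laplace c2 b"
    unfolding gauge_laplace_def by (subst nn_integral_add) (simp_all add: nn_integral_cmult)
  finally show ?thesis .
qed

lemma convex_polar_integral: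
  "convex_on (interior (supp f)) (\<lambda>z. enn2real (polar_integral s f z))"
  unfolding convex_on_def
proof (intro conjI ballI allI impI)
  show convex: "convex (interior (supp f))"
    by (rule convex_interior[OF convex_supp])
  fix a b and u v :: real
  assume ab: "a \<in> interior (supp f)" "b \<in> interior (supp f)" and uv: "0 \<le> u" "0 \<le> v" "u + v = 1"
  let ?J = "\<lambda>z. enn2real (polar_integral s f z)" and ?\<Gamma> = "Gamma (real DIM('a) + s + 1)"
  have "u *\<^sub>R a + v *\<^sub>R b \<in> interior (supp f)"
    using convex ab uv by (rule convexD)
  then have "ennreal (?\<Gamma> * ?J (u *\<^sub>R a + v *\<^sub>R b)) \<le> ennreal u * ennreal (?\<Gamma> * ?J a) + ennreal v * ennreal (?\<Gamma> * ?J b)"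
    using gauge_laplace_convex[of u v 1 1 1 "u *\<^sub>R a + v *\<^sub>R b" a b] uv ab
    by (simp add: gauge_laplace_eq)
  also have "\<dots> = ennreal (?\<Gamma> * (u * ?J a + v * ?J b))"
    using uv Gamma_dim_pos
    by (simp add: ennreal_mult'[symmetric] ennreal_plus[symmetric] distrib_left mult_ac del: ennreal_plus)
  finally show "?J (u *\<^sub>R a + v *\<^sub>R b) \<le> u * ?J a + v * ?J b"
    using uv Gamma_dim_pos by (simp add: ennreal_le_iff)
qed

text \<open>
  The standard passage from convexity to power concavity for a function of homogeneity degree
  \<open>- m\<close>: normalise both points to the value \<open>\<Gamma>(m + 1)\<close>, then the weights \<open>u \<alpha> / S\<close> and \<open>v \<beta> / S\<close> of the
  convex combination produce the sum \<open>S\<close> of the \<open>(-1/m)\<close>-th powers.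
\<close>
lemma concave_polar_integral_power:
  "concave_on (interior (supp f)) (\<lambda>z. enn2real (polar_integral s f z) powr (- 1 / (real DIM('a) + s)))"
  unfolding concave_on_iff
proof (intro conjI ballI allI impI)
  show convex: "convex (interior (supp f))"
    by (rule convex_interior[OF convex_supp])
  fix a b and u v :: real
  assume ab: "a \<in> interior (supp f)" "b \<in> interior (supp f)" and uv: "0 \<le> u" "0 \<le> v" "u + v = 1"
  let ?J = "\<lambda>z. enn2real (polar_integral s f z)" and ?\<Gamma> = "Gamma (real DIM('a) + s + 1)"
  define m where "m = real DIM('a) + s"
  have "m > 0" using s_pos by (simp add: m_def add_nonneg_pos)
  have J_pos: "?J z > 0" if "z \<in> interior (supp f)" for z
    using polar_integral_pos[of z] polar_integral_finite[OF that] by (simp add: enn2real_positive_iff)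
  define z where "z = u *\<^sub>R a + v *\<^sub>R b"
  have z: "z \<in> interior (supp f)"
    unfolding z_def using convex ab uv by (rule convexD)
  define \<alpha> \<beta> where "\<alpha> = ?J a powr (- 1 / m)" and "\<beta> = ?J b powr (- 1 / m)"
  \<comment> \<open>\<open>\<alpha>\<close> and \<open>\<beta>\<close> are the factors for which \<open>G\<^sub>a / \<alpha>\<close> and \<open>G\<^sub>b / \<beta>\<close> have equal Laplace transforms.\<close>
  have \<alpha>\<beta>: "\<alpha> > 0" "\<beta> > 0"
    using J_pos[OF ab(1)] J_pos[OF ab(2)] by (auto simp: \<alpha>_def \<beta>_def)
  define S where "S = u * \<alpha> + v * \<beta>"
  have "S > 0"
    using uv \<alpha>\<beta> unfolding S_def
    by (metis add_nonneg_pos add_pos_nonneg less_eq_real_def mult_nonneg_nonneg mult_pos_pos add_0 zero_neq_one)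
  have normalised: "gauge_laplace (1 / ?J x powr (- 1 / m)) x = ennreal ?\<Gamma>" if "x \<in> interior (supp f)" for x
  proof -
    have "1 / ?J x powr (- 1 / m) = ?J x powr (1 / m)"
      by (simp add: powr_minus inverse_eq_divide)
    moreover have "(?J x powr (1 / m)) powr (- m) * ?J x = 1"
      using J_pos[OF that] \<open>m > 0\<close> by (simp add: powr_powr powr_neg_one)
    moreover have "?J x powr (1 / m) > 0"
      using J_pos[OF that] by simp
    ultimately show ?thesis
      using gauge_laplace_eq[OF that, of "?J x powr (1 / m)"] by (simp only: m_def mult_1_right)
  qed
  have "gauge_laplace (1 / S) z \<le> ennreal (u * \<alpha> / S) * gauge_laplace (1 / \<alpha>) a + ennreal (v * \<beta> / S) * gauge_laplace (1 / \<beta>) b"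
  proof (rule gauge_laplace_convex)
    show "u * \<alpha> / S + v * \<beta> / S = 1"
      using \<open>S > 0\<close> by (simp add: S_def add_divide_distrib[symmetric])
    show "1 / S = u * \<alpha> / S * (1 / \<alpha>) + v * \<beta> / S * (1 / \<beta>)"
      using \<alpha>\<beta> uv by (simp add: add_divide_distrib[symmetric])
    show "(1 / S) *\<^sub>R z = (u * \<alpha> / S * (1 / \<alpha>)) *\<^sub>R a + (v * \<beta> / S * (1 / \<beta>)) *\<^sub>R b"
      using \<alpha>\<beta> by (simp add: z_def scaleR_add_right)
  qed (use uv \<alpha>\<beta> \<open>S > 0\<close> in auto)
  also have "\<dots> = ennreal (u * \<alpha> / S) * ennreal ?\<Gamma> + ennreal (v * \<beta> / S) * ennreal ?\<Gamma>"
    using normalised[OF ab(1)] normalised[OF ab(2)] by (simp only: \<alpha>_def \<beta>_def)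
  also have "\<dots> = ennreal ((u * \<alpha> / S + v * \<beta> / S) * ?\<Gamma>)"
  proof -
    have "0 \<le> u * \<alpha> / S" "0 \<le> v * \<beta> / S"
      using uv \<alpha>\<beta> \<open>S > 0\<close> by simp_all
    then show ?thesis
      by (simp only: ennreal_mult'[OF add_nonneg_nonneg] ennreal_plus distrib_right[where 'a = ennreal])
  qed
  also have "u * \<alpha> / S + v * \<beta> / S = 1"
    using \<open>S > 0\<close> by (simp add: S_def add_divide_distrib[symmetric])
  finally have "ennreal (?\<Gamma> * ((1 / S) powr (- m) * ?J z)) \<le> ennreal ?\<Gamma>"
    using z \<open>S > 0\<close> by (simp add: gauge_laplace_eq m_def)
  then have "(1 / S) powr (- m) * ?J z \<le> 1"
    using Gamma_dim_pos by (simp add: ennreal_le_iff mult_le_cancel_left1)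
  then have "?J z \<le> S powr (- m)"
    using \<open>S > 0\<close> by (simp add: powr_divide powr_minus field_simps)
  then have "(S powr (- m)) powr (- 1 / m) \<le> ?J z powr (- 1 / m)"
    using J_pos[OF z] \<open>m > 0\<close> by (intro powr_mono2') auto
  then have "S \<le> ?J z powr (- 1 / m)"
    using \<open>S > 0\<close> \<open>m > 0\<close> by (simp add: powr_powr)
  then show "u * ?J a powr (- 1 / (real DIM('a) + s)) + v * ?J b powr (- 1 / (real DIM('a) + s))
      \<le> ?J (u *\<^sub>R a + v *\<^sub>R b) powr (- 1 / (real DIM('a) + s))"
    by (simp add: S_def \<alpha>_def \<beta>_def m_def z_def)
qed

section \<open>The minimum and its barycenter\<close>

text \<open>
  Fatou's lemma replaces continuity: the value of the Laplace transform at a limit point in the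
  closure of the support is at most the infimum, in particular finite, and finiteness excludes the
  boundary.
\<close>
lemma polar_integral_attains_minimum:
  obtains z0 where "z0 \<in> interior (supp f)" "\<And>z. polar_integral s f z0 \<le> polar_integral s f z"
proof -
  let ?U = "interior (supp f)" and ?\<Gamma> = "ennreal (Gamma (real DIM('a) + s + 1))"
  have \<Gamma>: "?\<Gamma> \<noteq> 0" "?\<Gamma> \<noteq> top" using Gamma_dim_pos by auto
  have U_closure: "?U \<subseteq> closure (supp f)"
    using interior_subset closure_subset by blast
  obtain u where u: "\<And>n. u n \<in> gauge_laplace 1 ` ?U" "u \<longlonglongrightarrow> Inf (gauge_laplace 1 ` ?U)"
    using Inf_as_limit[of "gauge_laplace 1 ` ?U"] interior_supp by auto
  from u(1) have "\<forall>n. \<exists>x. x \<in> ?U \<and> u n = gauge_laplace 1 x"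
    by auto
  then obtain x where x: "\<And>n. x n \<in> ?U" "\<And>n. u n = gauge_laplace 1 (x n)"
    by metis
  have "seq_compact (closure (supp f))"
    using bounded_supp by (intro compact_imp_seq_compact) simp
  moreover have "\<forall>n. x n \<in> closure (supp f)"
    using x(1) U_closure by blast
  ultimately obtain z0 r where r: "z0 \<in> closure (supp f)" "strict_mono r" "(x \<circ> r) \<longlonglongrightarrow> z0"
    by (rule seq_compactE)
  have "gauge_laplace 1 z0 = (\<integral>\<^sup>+p. liminf (\<lambda>n. indicator {p. 0 < snd p} p *
      ennreal (exp (- (1 * polar_gauge (x (r n)) p)))) \<partial>lborel)"
    unfolding gauge_laplace_def
  proof (intro nn_integral_cong)
    fix p :: "'a \<times> real"
    have "(\<lambda>n. polar_gauge (x (r n)) p) \<longlonglongrightarrow> polar_gauge z0 p"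
      unfolding polar_gauge_def using r(3) by (intro tendsto_intros) (simp add: o_def)
    then have "(\<lambda>n. ennreal (exp (- (1 * polar_gauge (x (r n)) p)))) \<longlonglongrightarrow> ennreal (exp (- (1 * polar_gauge z0 p)))"
      by (intro tendsto_intros)
    then have "(\<lambda>n. indicator {p. 0 < snd p} p * ennreal (exp (- (1 * polar_gauge (x (r n)) p))))
        \<longlonglongrightarrow> indicator {p. 0 < snd p} p * ennreal (exp (- (1 * polar_gauge z0 p)))"
      by (cases "0 < snd p") auto
    then show "indicator {p. 0 < snd p} p * ennreal (exp (- (1 * polar_gauge z0 p))) =
        liminf (\<lambda>n. indicator {p. 0 < snd p} p * ennreal (exp (- (1 * polar_gauge (x (r n)) p))))"
      by (intro lim_imp_Liminf[symmetric]) auto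
  qed
  also have "\<dots> \<le> liminf (\<lambda>n. gauge_laplace 1 (x (r n)))"
    unfolding gauge_laplace_def by (rule nn_integral_liminf) measurable
  also have "\<dots> = Inf (gauge_laplace 1 ` ?U)"
    using LIMSEQ_subseq_LIMSEQ[OF u(2) r(2)] by (intro lim_imp_Liminf) (auto simp: o_def x(2))
  finally have le_Inf: "gauge_laplace 1 z0 \<le> Inf (gauge_laplace 1 ` ?U)" .
  have "z0 \<in> ?U"
  proof (rule ccontr)
    assume "z0 \<notin> ?U"
    then have "gauge_laplace 1 z0 = \<infinity>"
      using polar_integral_outside_interior \<Gamma> by (simp add: gauge_laplace_polar_integral[OF r(1)] ennreal_mult_top)
    moreover have "Inf (gauge_laplace 1 ` ?U) \<le> gauge_laplace 1 (x 0)"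
      using x(1) by (intro Inf_lower) auto
    moreover have "gauge_laplace 1 (x 0) < \<infinity>"
      using x(1) by (simp add: gauge_laplace_eq)
    ultimately show False
      using le_Inf by simp
  qed
  moreover have "polar_integral s f z0 \<le> polar_integral s f z" for z
  proof (cases "z \<in> ?U")
    case True
    then have "gauge_laplace 1 z0 \<le> gauge_laplace 1 z"
      using le_Inf by (simp add: le_INF_iff)
    then show ?thesis
      using True U_closure r(1) \<Gamma>
      by (auto simp: gauge_laplace_polar_integral subset_iff ennreal_mult_le_mult_iff)
  next
    case False
    then show ?thesis by (simp add: polar_integral_outside_interior)
  qed
  ultimately show ?thesis by (rule that)
qed

text \<open>
  Each coordinate \<open>a(v, \<lambda>) = \<langle>v, e\<rangle>\<close> has mean zero with respect to the measure \<open>\<mu>\<close> with density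
  \<open>exp (- G)\<close>, since its exponential moments are the values of the Laplace transform on the line
  through the minimum in direction \<open>e\<close>. The moment identity, which is available for nonnegative
  weights, transfers this to the polar separately for the positive and the negative part.
\<close>
lemma is_barycenter_at_minimum:
  assumes z0: "z0 \<in> interior (supp f)" and min: "\<And>z. polar_integral s f z0 \<le> polar_integral s f z"
  shows "is_barycenter (\<lambda>y. enn2real (s_polar s (shift f z0) y)) 0"
proof -
  define g where "g y = enn2real (s_polar s (shift f z0) y)" for y
  have [measurable]: "g \<in> borel_measurable borel"
    unfolding g_def[abs_def] using s_pos by measurable
  have g_nonneg: "g y \<ge> 0" for y by (simp add: g_def)
  have g_eq: "ennreal (g y) = s_polar s (shift f z0) y" for y
    using s_polar_finite[of z0 y] by (simp add: g_def)
  obtain B R where BR: "\<And>y. s_polar s (shift f z0) y \<le> ennreal B * indicator (cball 0 R) y" "B \<ge> 0"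
    using s_polar_compact_support[OF z0] by blast
  have g_bound: "g y \<le> B" for y
  proof -
    have "s_polar s (shift f z0) y \<le> ennreal B"
      using BR(1)[of y] by (rule order_trans) (simp add: indicator_def)
    then show ?thesis
      unfolding g_def by (rule enn2real_leI[OF BR(2)])
  qed
  have g_support: "g y = 0" if "y \<notin> cball 0 R" for y
    using BR(1)[of y] that by (simp add: g_def)
  have g_int: "integrable lborel g"
    by (rule integrableI_bounded_set[where A = "cball 0 R" and B = B])
      (use g_bound g_nonneg g_support emeasure_lborel_cball_finite in auto)
  have gy_int: "integrable lborel (\<lambda>y. g y *\<^sub>R y)"
  proof (rule integrableI_bounded_set[where A = "cball 0 R" and B = "B * R"])
    show "AE y in lborel. y \<in> cball 0 R \<longrightarrow> norm (g y *\<^sub>R y) \<le> B * R"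
      using g_bound g_nonneg BR(2) by (auto intro!: mult_mono)
  qed (use g_support emeasure_lborel_cball_finite in auto)
  have "(\<integral>y. g y \<partial>lborel) = enn2real (polar_integral s f z0)"
    using g_nonneg by (subst integral_eq_nn_integral) (auto simp: polar_integral_def g_eq)
  then have g_ne: "(\<integral>y. g y \<partial>lborel) \<noteq> 0"
    using polar_integral_pos[of z0] polar_integral_finite[OF z0]
    by (simp add: enn2real_eq_0_iff less_top)
  have component: "(\<integral>y. g y * (y \<bullet> e) \<partial>lborel) = 0" if e: "e \<in> Basis" for e
  proof -
    define \<mu> where "\<mu> = density lborel (\<lambda>p :: 'a \<times> real. indicator {p. 0 < snd p} p * ennreal (exp (- polar_gauge z0 p)))"
    have sets_\<mu>: "borel_measurable \<mu> = borel_measurable borel"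
      unfolding \<mu>_def by (rule measurable_cong_sets) simp_all
    define a where "a p = fst p \<bullet> e" for p :: "'a \<times> real"
    have [measurable]: "a \<in> borel_measurable borel"
      unfolding a_def[abs_def] by measurable
    obtain r where r: "r > 0" "ball z0 r \<subseteq> interior (supp f)"
      using z0 by (meson open_contains_ball open_interior)
    have in_U: "z0 + \<epsilon> *\<^sub>R e \<in> interior (supp f)" if "\<bar>\<epsilon>\<bar> \<le> r / 2" for \<epsilon>
      using that r e by (intro subsetD[OF r(2)]) (simp add: dist_norm)
    have moment: "(\<integral>\<^sup>+p. ennreal (exp (\<epsilon> * a p)) \<partial>\<mu>) = gauge_laplace 1 (z0 + \<epsilon> *\<^sub>R e)" for \<epsilon>
    proof -
      have "(\<integral>\<^sup>+p. ennreal (exp (\<epsilon> * a p)) \<partial>\<mu>) = (\<integral>\<^sup>+p. indicator {p. 0 < snd p} p *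
          ennreal (exp (- polar_gauge z0 p)) * ennreal (exp (\<epsilon> * a p)) \<partial>lborel)"
        unfolding \<mu>_def by (rule nn_integral_density) measurable
      also have "\<dots> = gauge_laplace 1 (z0 + \<epsilon> *\<^sub>R e)"
        unfolding gauge_laplace_def
      proof (intro nn_integral_cong)
        fix p :: "'a \<times> real"
        have "- polar_gauge z0 p + \<epsilon> * a p = - (1 * polar_gauge (z0 + \<epsilon> *\<^sub>R e) p)"
          by (simp add: polar_gauge_def a_def inner_add_left inner_commute[of e])
        then show "indicator {p. 0 < snd p} p * ennreal (exp (- polar_gauge z0 p)) * ennreal (exp (\<epsilon> * a p)) =
            indicator {p. 0 < snd p} p * ennreal (exp (- (1 * polar_gauge (z0 + \<epsilon> *\<^sub>R e) p)))"
          by (simp only: mult.assoc ennreal_mult'[symmetric] exp_ge_zero exp_add[symmetric])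
      qed
      finally show ?thesis .
    qed
    have finite_moment: "gauge_laplace 1 (z0 + \<epsilon> *\<^sub>R e) < \<infinity>" if "\<bar>\<epsilon>\<bar> \<le> r / 2" for \<epsilon>
      using in_U[OF that] by (simp add: gauge_laplace_eq)
    have moment_integral: "(\<integral>p. exp (\<epsilon> * a p) \<partial>\<mu>) = enn2real (gauge_laplace 1 (z0 + \<epsilon> *\<^sub>R e))" for \<epsilon>
      by (subst integral_eq_nn_integral) (auto simp: sets_\<mu> moment)
    have stationary: "integrable \<mu> a" "(\<integral>p. a p \<partial>\<mu>) = 0"
    proof -
      have int: "integrable \<mu> (\<lambda>p. exp (\<epsilon> * a p))" if "\<bar>\<epsilon>\<bar> \<le> r / 2" for \<epsilon>
        using finite_moment[OF that] by (intro integrableI_nonneg) (auto simp: sets_\<mu> moment)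
      have le: "(\<integral>p. exp (0 * a p) \<partial>\<mu>) \<le> (\<integral>p. exp (\<epsilon> * a p) \<partial>\<mu>)" if "\<bar>\<epsilon>\<bar> \<le> r / 2" for \<epsilon>
      proof -
        have "z0 \<in> closure (supp f)" "z0 + \<epsilon> *\<^sub>R e \<in> closure (supp f)"
          using z0 in_U[OF that] interior_subset closure_subset by blast+
        then have "gauge_laplace 1 z0 \<le> gauge_laplace 1 (z0 + \<epsilon> *\<^sub>R e)"
          using min by (simp add: gauge_laplace_polar_integral mult_left_mono)
        then show ?thesis
          unfolding moment_integral using finite_moment[OF that] by (auto intro!: enn2real_mono)
      qed
      have meas: "a \<in> borel_measurable \<mu>" by (simp add: sets_\<mu>)
      have "r / 2 > 0" using r(1) by simp
      from integral_eq_0_if_exp_moment_minimal[OF meas this int le]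
      show "integrable \<mu> a" "(\<integral>p. a p \<partial>\<mu>) = 0" by auto
    qed
    let ?\<Gamma> = "Gamma (real DIM('a) + s + 1 + 1)"
    \<comment> \<open>As \<open>ennreal\<close> truncates at zero, \<open>\<sigma> = 1\<close> and \<open>\<sigma> = - 1\<close> give the two parts.\<close>
    have part: "(\<integral>\<^sup>+p. ennreal (\<sigma> * a p) \<partial>\<mu>) = ennreal ?\<Gamma> * (\<integral>\<^sup>+y. ennreal (\<sigma> * (g y * (y \<bullet> e))) \<partial>lborel)" for \<sigma>
    proof -
      have "(\<integral>\<^sup>+p. ennreal (\<sigma> * a p) \<partial>\<mu>) =
          (\<integral>\<^sup>+p. ennreal (\<sigma> * (fst p \<bullet> e)) * indicator {p. 0 < snd p} p * ennreal (exp (- polar_gauge z0 p)) \<partial>lborel)"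
        unfolding \<mu>_def by (subst nn_integral_density) (auto simp: a_def mult_ac intro!: nn_integral_cong)
      also have "\<dots> = ennreal ?\<Gamma> * (\<integral>\<^sup>+y. ennreal (\<sigma> * (y \<bullet> e)) * s_polar s (shift f z0) y \<partial>lborel)"
      proof (rule polar_moment_laplace)
        show "z0 \<in> closure (supp f)"
          using z0 interior_subset closure_subset by blast
        show "ennreal (\<sigma> * (t *\<^sub>R v \<bullet> e)) = ennreal (t powr 1) * ennreal (\<sigma> * (v \<bullet> e))" if "t > 0" for t v
          using that by (simp add: ennreal_mult'[symmetric] mult_ac)
      qed auto
      also have "(\<integral>\<^sup>+y. ennreal (\<sigma> * (y \<bullet> e)) * s_polar s (shift f z0) y \<partial>lborel) =
          (\<integral>\<^sup>+y. ennreal (\<sigma> * (g y * (y \<bullet> e))) \<partial>lborel)"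
      proof (intro nn_integral_cong)
        fix y :: 'a
        have "\<sigma> * (g y * (y \<bullet> e)) = g y * (\<sigma> * (y \<bullet> e))"
          by simp
        then show "ennreal (\<sigma> * (y \<bullet> e)) * s_polar s (shift f z0) y = ennreal (\<sigma> * (g y * (y \<bullet> e)))"
          by (simp only: g_eq[symmetric] ennreal_mult'[OF g_nonneg] mult.commute)
      qed
      finally show ?thesis .
    qed
    have "0 < ?\<Gamma>"
      using s_pos by (intro Gamma_real_pos) linarith
    have "integrable lborel (\<lambda>y. (g y *\<^sub>R y) \<bullet> e)"
      using gy_int by (rule integrable_inner_left)
    then have "(\<integral>y. g y * (y \<bullet> e) \<partial>lborel) =
        enn2real (\<integral>\<^sup>+y. ennreal (1 * (g y * (y \<bullet> e))) \<partial>lborel) - enn2real (\<integral>\<^sup>+y. ennreal (- 1 * (g y * (y \<bullet> e))) \<partial>lborel)"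
      by (subst real_lebesgue_integral_def) auto
    moreover have "(\<integral>p. a p \<partial>\<mu>) = enn2real (\<integral>\<^sup>+p. ennreal (1 * a p) \<partial>\<mu>) - enn2real (\<integral>\<^sup>+p. ennreal (- 1 * a p) \<partial>\<mu>)"
      using stationary(1) by (subst real_lebesgue_integral_def) auto
    ultimately have "?\<Gamma> * (\<integral>y. g y * (y \<bullet> e) \<partial>lborel) = (\<integral>p. a p \<partial>\<mu>)"
      using \<open>0 < ?\<Gamma>\<close> by (simp only: part enn2real_mult) (simp add: right_diff_distrib)
    then show ?thesis
      using stationary(2) \<open>0 < ?\<Gamma>\<close> by simp
  qed
  have "(\<integral>y. g y *\<^sub>R y \<partial>lborel) = 0"
  proof (rule euclidean_eqI)
    fix e :: 'a assume e: "e \<in> Basis"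
    have "(\<integral>y. g y *\<^sub>R y \<partial>lborel) \<bullet> e = (\<integral>y. (g y *\<^sub>R y) \<bullet> e \<partial>lborel)"
      by (rule integral_inner_left[symmetric]) (rule gy_int)
    then show "(\<integral>y. g y *\<^sub>R y \<partial>lborel) \<bullet> e = 0 \<bullet> e"
      using component[OF e] by simp
  qed
  then have "is_barycenter g 0"
    using g_int gy_int g_ne by (simp add: is_barycenter_def)
  then show ?thesis
    by (simp add: g_def[abs_def])
qed

end

theorem theorem1:
  fixes f :: "'a::euclidean_space \<Rightarrow> real" and s :: real
  assumes "s > 0"
    and "\<And>x. f x \<ge> 0"
    and "upper_semicontinuous f"
    and "one_over_s_concave s f"
    and "integrable lborel f"
  shows
    "(\<forall>z\<in>interior (supp f). 0 < polar_integral s f z \<and> polar_integral s f z < \<infinity>) \<and>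
     convex_on (interior (supp f)) (\<lambda>z. enn2real (polar_integral s f z)) \<and>
     (interior (supp f) \<noteq> {} \<longrightarrow>
       (\<exists>z0\<in>interior (supp f).
          (\<forall>z. polar_integral s f z0 \<le> polar_integral s f z) \<and>
          is_barycenter (\<lambda>y. enn2real (s_polar s (shift f z0) y)) 0)) \<and>
     concave_on (interior (supp f))
       (\<lambda>z. enn2real (polar_integral s f z) powr (- 1 / (real DIM('a) + s)))"
proof (cases "interior (supp f) = {}")
  case True
  then show ?thesis by (simp add: convex_on_def concave_on_def)
next
  case False
  then interpret concave_power s f
    using assms by unfold_locales (auto simp: one_over_s_concave_def)
  obtain z0 where "z0 \<in> interior (supp f)" "\<And>z. polar_integral s f z0 \<le> polar_integral s f z"
    using polar_integral_attains_minimum by blast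
  then show ?thesis
    using polar_integral_pos polar_integral_finite convex_polar_integral concave_polar_integral_power
      is_barycenter_at_minimum by blast
qed

end
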